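(* Let $l_1>0$ and $\varepsilon\ge 1$. For $v\in[-1,1]$ consider the equation $$F(v):=\mathbb{E}_{(Z_1,Z_2)\sim\mathrm{BVN}(\rho)}\Big[1\wedge e^{-l_1Z_1-l_1^2/2}\wedge e^{-l_1Z_2-l_1^2/2}\Big]-2v\Phi(-l_1/2)=0,$$ where $\rho=\rho(v)$ is $\rho_{\mathrm{crn}}=v$ (CRN), $\rho_{\mathrm{refl}}=v+\varepsilon^{-1}(1-v)$ (reflection), or $\rho_{\mathrm{gcrn}}=1$ (GCRN). The solutions are: (i) GCRN: $v_{\mathrm{gcrn}}=1$. (ii) CRN: $v_{\mathrm{crn}}\in(0,1)$ and $v_u=1$. (iii) Reflection with $\varepsilon>1$: $v_{\mathrm{refl}}\in(v_{\mathrm{crn}},1)$ and $v_u=1$; moreover $v_{\mathrm{refl}}$ is a decreasing function of $\varepsilon\in(1,\infty)$ with $v_{\mathrm{refl}}\to 1$ as $\varepsilon\to1$ and $v_{\mathrm{refl}}\to v_{\mathrm{crn}}$ as $\varepsilon\to\infty$. The solutions $v_{\mathrm{crn}},v_{\mathrm{refl}}$ are decreasing in $l_1$, and $\lim_{l_1\to0}v_{\mathrm{crn}}=\lim_{l_1\to0}v_{\mathrm{refl}}=1$, $\lim_{l_1\to\infty}v_{\mathrm{crn}}=\lim_{l_1\to\infty}v_{\mathrm{refl}}=0$. The solution $v_u=1$ is unstable for both the CRN and reflection couplings, in the sense that $\partial_vF(v)\to\infty$ as $v\nearrow1$; the solutions $v_{\mathrm{crn}}$, $v_{\mathrm{refl}}$,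 $v_{\mathrm{gcrn}}$ under the respective couplings are stable, in the sense that $\partial_vF$ is strictly negative at these values.
   Context: $\Phi$ is the standard normal cdf; $\mathrm{BVN}(\rho)$ denotes the bivariate normal distribution with zero means, unit variances and correlation $\rho$. (In the paper, $l_1$ is the rescaled step size and $\varepsilon$ the limiting ellipticity $\lim_d \{\mathrm{tr}(\Sigma_{(d)}^{-1})/d\}\{\mathrm{tr}(\Sigma_{(d)})/d\}\ge 1$ of a sequence of Gaussian targets $\mathcal{N}_d(0,\Sigma_{(d)})$.) *)

theory Defs
  imports "HOL-Probability.Probability"
begin

definition std_normal :: "real measure" where
  "std_normal = density lborel std_normal_density"

definition Phi :: "real \<Rightarrow> real" where
  "Phi x = measure std_normal {..x}"

definition bvn :: "real \<Rightarrow> (real \<times> real) measure" where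
  "bvn \<rho> = distr (std_normal \<Otimes>\<^sub>M std_normal) borel
              (\<lambda>(x, y). (x, \<rho> * x + sqrt (1 - \<rho>\<^sup>2) * y))"

definition Fgen :: "real \<Rightarrow> real \<Rightarrow> real \<Rightarrow> real" where
  "Fgen l1 \<rho> v =
     (\<integral>z. min 1 (min (exp (- l1 * fst z - l1\<^sup>2 / 2)) (exp (- l1 * snd z - l1\<^sup>2 / 2))) \<partial>bvn \<rho>)
     - 2 * v * Phi (- l1 / 2)"

definition F_crn :: "real \<Rightarrow> real \<Rightarrow> real" where
  "F_crn l1 v = Fgen l1 v v"

definition F_refl :: "real \<Rightarrow> real \<Rightarrow> real \<Rightarrow> real" where
  "F_refl l1 \<epsilon> v = Fgen l1 (v + (1 - v) / \<epsilon>) v"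

definition F_gcrn :: "real \<Rightarrow> real \<Rightarrow> real" where
  "F_gcrn l1 v = Fgen l1 1 v"

end

theory Submission
  imports Defs
begin

text \<open>The acceptance functional is \<open>E[h(max(Z\<^sub>1, Z\<^sub>2))]\<close> with \<open>h(s) = min(1, exp(-l s - l\<^sup>2/2))\<close>, and
  \<open>max(Z\<^sub>1, Z\<^sub>2)\<close> has the skew-normal density \<open>2 \<phi>(s) \<Phi>(k s)\<close>, where
  \<open>k = sqrt((1 - \<rho>) / (1 + \<rho>))\<close>. Differentiating in \<open>k\<close> and integrating by parts shows that the
  derivative in \<open>\<rho>\<close> is
  \<open>(2 \<pi> sqrt(1 - \<rho>\<^sup>2))\<^sup>-\<^sup>1 \<integral>\<^bsub>s > -l/2\<^esub> l exp(-l s - l\<^sup>2/2 - s\<^sup>2/(1 + \<rho>)) ds\<close>, which is positive and strictly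
  increasing on \<open>[0, 1)\<close> and tends to infinity at 1. Hence \<open>F\<close> is strictly convex on \<open>[0, 1]\<close>,
  positive at 0, zero at 1 and of infinite slope there, so it has exactly one zero in \<open>(0, 1)\<close>, and
  it changes sign from plus to minus there. All monotonicity and limit statements then follow from the
  sign of \<open>F\<close> at a test point. For the dependence on \<open>l\<close>, the quotient of the functional by
  \<open>2 \<Phi>(-l/2)\<close> is the mean of \<open>2 \<Phi>(k s)\<close> under the density proportional to \<open>h \<phi>\<close>, which decreases
  in \<open>l\<close> in the likelihood ratio order.\<close>

subsection \<open>The standard normal law\<close>

lemma real_distribution_std_normal: "real_distribution std_normal"
  unfolding std_normal_def by (rule real_dist_normal_dist)

lemma prob_space_std_normal: "prob_space std_normal"
  using real_distribution_std_normal unfolding real_distribution_def by blast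

lemma sets_std_normal [simp, measurable_cong]: "sets std_normal = sets borel"
  by (simp add: std_normal_def)

lemma space_std_normal [simp]: "space std_normal = UNIV"
  by (simp add: std_normal_def)

lemma std_normal_density_pos: "0 < std_normal_density x"
  by (simp add: normal_density_pos)

lemma integrable_std_normal_density [simp]: "integrable lborel std_normal_density"
  using integrable_std_normal_moment[of 0] by simp

lemma integral_std_normal_density [simp]: "integral\<^sup>L lborel std_normal_density = 1"
  using integral_std_normal_moment_even[of 0] by simp

lemma continuous_std_normal_density: "continuous_on S std_normal_density"
  unfolding std_normal_density_def by (intro continuous_intros) auto

lemma std_normal_density_minus [simp]: "std_normal_density (- x) = std_normal_density x"
  by (simp add: std_normal_density_def)

text \<open>A crude consequence of \<open>pi > 3\<close>; it supplies the Lipschitz constant 1 of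
  \<open>Phi\<close>.\<close>

lemma std_normal_density_le_half: "std_normal_density x \<le> 1 / 2"
proof -
  have "2 \<le> sqrt (2 * pi)"
    using pi_gt3 by (intro real_le_rsqrt) simp
  then have "1 / sqrt (2 * pi) \<le> 1 / 2"
    by (intro divide_left_mono) auto
  moreover have "exp (- x\<^sup>2 / 2) \<le> 1" by simp
  ultimately have "1 / sqrt (2 * pi) * exp (- x\<^sup>2 / 2) \<le> 1 / 2 * 1"
    by (intro mult_mono) auto
  then show ?thesis by (simp add: std_normal_density_def)
qed

lemma integral_std_normal_indicator:
  assumes [measurable]: "A \<in> sets borel"
  shows "measure std_normal A = (\<integral>x. std_normal_density x * indicator A x \<partial>lborel)"
proof -
  interpret prob_space std_normal by (rule prob_space_std_normal)
  have "measure std_normal A = (\<integral>x. indicator A x \<partial>std_normal)" by simp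
  also have "\<dots> = (\<integral>x. std_normal_density x * indicator A x \<partial>lborel)"
    unfolding std_normal_def by (subst integral_density) auto
  finally show ?thesis .
qed

lemma Phi_eq_integral: "Phi x = (\<integral>s. std_normal_density s * indicator {..x} s \<partial>lborel)"
  unfolding Phi_def by (rule integral_std_normal_indicator) simp

lemma integrable_indicator_density:
  "A \<in> sets borel \<Longrightarrow> integrable lborel (\<lambda>s. std_normal_density s * indicator A s)"
  using integrable_mult_indicator[of A lborel std_normal_density]
  by (simp add: mult.commute)

lemma nn_integral_std_normal_atMost:
  "(\<integral>\<^sup>+s. ennreal (std_normal_density s) * indicator {..x} s \<partial>lborel) = ennreal (Phi x)"
proof -
  interpret prob_space std_normal by (rule prob_space_std_normal)
  have "(\<integral>\<^sup>+s. ennreal (std_normal_density s) * indicator {..x} s \<partial>lborel) = emeasure std_normal {..x}"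
    unfolding std_normal_def by (subst emeasure_density) auto
  then show ?thesis by (simp add: Phi_def emeasure_eq_measure)
qed

text \<open>Substitute \<open>x = m + \<sigma> * u\<close>. Given the first coordinate of a
  correlated pair, the second is normal with mean \<rho> times that coordinate and standard
  deviation \<open>sqrt (1 - \<rho>\<^sup>2)\<close>; this evaluates its conditional distribution
  function.\<close>

lemma nn_integral_std_normal_affine_atMost:
  assumes "0 < \<sigma>"
  shows "(\<integral>\<^sup>+x. ennreal (std_normal_density ((x - m) / \<sigma>) / \<sigma>) * indicator {..b} x \<partial>lborel) = ennreal (Phi ((b - m) / \<sigma>))"
proof -
  have "(\<integral>\<^sup>+x. ennreal (std_normal_density ((x - m) / \<sigma>) / \<sigma>) * indicator {..b} x \<partial>lborel)
      = ennreal \<bar>\<sigma>\<bar> * (\<integral>\<^sup>+u. ennreal (std_normal_density (((m + \<sigma> * u) - m) / \<sigma>) / \<sigma>) * indicator {..b} (m + \<sigma> * u) \<partial>lborel)"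
    using assms by (intro nn_integral_real_affine) auto
  also have "\<dots> = (\<integral>\<^sup>+u. ennreal \<sigma> * (ennreal (std_normal_density (((m + \<sigma> * u) - m) / \<sigma>) / \<sigma>) * indicator {..b} (m + \<sigma> * u)) \<partial>lborel)"
    using assms by (subst nn_integral_cmult) auto
  also have "\<dots> = (\<integral>\<^sup>+u. ennreal (std_normal_density u) * indicator {..(b - m) / \<sigma>} u \<partial>lborel)"
  proof (intro nn_integral_cong)
    fix u :: real
    have "(m + \<sigma> * u \<le> b) = (u \<le> (b - m) / \<sigma>)"
      using assms by (simp add: field_simps)
    then show "ennreal \<sigma> * (ennreal (std_normal_density (((m + \<sigma> * u) - m) / \<sigma>) / \<sigma>) * indicator {..b} (m + \<sigma> * u))
       = ennreal (std_normal_density u) * indicator {..(b - m) / \<sigma>} u"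
      using assms by (auto simp: indicator_def ennreal_mult'[symmetric] simp del: ennreal_mult)
  qed
  finally show ?thesis by (simp add: nn_integral_std_normal_atMost)
qed

lemma Phi_mono: "x \<le> y \<Longrightarrow> Phi x \<le> Phi y"
proof -
  interpret prob_space std_normal by (rule prob_space_std_normal)
  show "x \<le> y \<Longrightarrow> Phi x \<le> Phi y"
    unfolding Phi_def by (intro finite_measure_mono) auto
qed

lemma Phi_nonneg: "0 \<le> Phi x" by (simp add: Phi_def)

lemma Phi_le_1: "Phi x \<le> 1"
  unfolding Phi_def using prob_space.prob_le_1[OF prob_space_std_normal] .

lemma Phi_at_bot: "(Phi \<longlongrightarrow> 0) at_bot"
proof -
  interpret real_distribution std_normal by (rule real_distribution_std_normal)
  have "Phi = cdf std_normal" by (auto simp: Phi_def cdf_def)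
  then show ?thesis using cdf_lim_at_bot by simp
qed

lemma Phi_diff:
  assumes "a \<le> b"
  shows "Phi b - Phi a = integral {a..b} std_normal_density"
proof -
  have "Phi b - Phi a = (\<integral>s. std_normal_density s * indicator {..b} s - std_normal_density s * indicator {..a} s \<partial>lborel)"
    unfolding Phi_eq_integral by (intro Bochner_Integration.integral_diff[symmetric] integrable_indicator_density) auto
  also have "\<dots> = (\<integral>s. indicator {a<..b} s *\<^sub>R std_normal_density s \<partial>lborel)"
    using assms by (intro Bochner_Integration.integral_cong) (auto simp: indicator_def)
  also have "\<dots> = (LINT s : {a<..b} | lborel. std_normal_density s)"
    by (simp add: set_lebesgue_integral_def)
  also have "\<dots> = (LBINT s=a..b. std_normal_density s)"
    using assms by (simp add: interval_integral_Ioc)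
  also have "\<dots> = integral {a..b} std_normal_density"
    using assms by (intro interval_integral_eq_integral borel_integrable_atLeastAtMost' continuous_std_normal_density)
  finally show ?thesis .
qed

lemma Phi_has_derivative: "(Phi has_real_derivative std_normal_density x) (at x)"
proof -
  have "((\<lambda>u. integral {x-1..u} std_normal_density) has_real_derivative std_normal_density x) (at x within {x-1..x+1})"
    by (intro integral_has_real_derivative continuous_std_normal_density) auto
  then have "((\<lambda>u. integral {x-1..u} std_normal_density) has_real_derivative std_normal_density x) (at x)"
    by (simp add: at_within_Icc_at)
  then have *: "((\<lambda>u. Phi (x-1) + integral {x-1..u} std_normal_density) has_real_derivative std_normal_density x) (at x)"
    by (auto intro!: derivative_eq_intros)
  show ?thesis
    by (rule has_field_derivative_transform_within[OF *, of 1]) (auto simp: Phi_diff[symmetric] dist_real_def)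
qed

lemma DERIV_Phi [derivative_intros]:
  "(f has_real_derivative D) (at x within S) \<Longrightarrow>
    ((\<lambda>x. Phi (f x)) has_real_derivative std_normal_density (f x) * D) (at x within S)"
  using DERIV_chain2[OF Phi_has_derivative] by simp

lemma Phi_strict_mono: "x < y \<Longrightarrow> Phi x < Phi y"
  by (rule DERIV_pos_imp_increasing) (use Phi_has_derivative std_normal_density_pos in blast)+

lemma Phi_pos: "0 < Phi x"
  using Phi_strict_mono[of "x - 1" x] Phi_nonneg[of "x - 1"] by simp

lemma isCont_Phi: "isCont Phi x"
  using Phi_has_derivative DERIV_isCont by blast

lemma continuous_on_Phi [continuous_intros]:
  "continuous_on S f \<Longrightarrow> continuous_on S (\<lambda>x. Phi (f x))"
  by (rule continuous_on_compose2[of UNIV Phi]) (auto simp: isCont_Phi intro!: continuous_at_imp_continuous_on)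

lemma tendsto_Phi [tendsto_intros]: "(f \<longlongrightarrow> a) F \<Longrightarrow> ((\<lambda>x. Phi (f x)) \<longlongrightarrow> Phi a) F"
  using isCont_Phi by (rule isCont_tendsto_compose)

lemma borel_measurable_Phi [measurable]: "Phi \<in> borel_measurable borel"
  by (intro borel_measurable_continuous_onI continuous_on_Phi continuous_intros)

lemma Phi_minus: "Phi (- x) = 1 - Phi x"
proof -
  have "Phi (- x) = (\<integral>s. std_normal_density s * indicator {..-x} s \<partial>lborel)"
    by (rule Phi_eq_integral)
  also have "\<dots> = (\<integral>s. std_normal_density s * indicator {x..} s \<partial>lborel)"
    by (subst lborel_integral_real_affine[where c="-1" and t=0])
       (auto intro!: Bochner_Integration.integral_cong simp: indicator_def)
  \<comment> \<open>The two integrands differ only at the single point x, which is null.\<close>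
  also have "\<dots> = (\<integral>s. std_normal_density s - std_normal_density s * indicator {..x} s \<partial>lborel)"
    using AE_lborel_singleton[of x]
    by (intro integral_cong_AE) (auto simp: indicator_def elim!: eventually_mono)
  also have "\<dots> = 1 - Phi x"
    unfolding Phi_eq_integral by (subst Bochner_Integration.integral_diff) (auto intro: integrable_indicator_density)
  finally show ?thesis .
qed

lemma Phi_0: "Phi 0 = 1 / 2"
  using Phi_minus[of 0] by simp

text \<open>Mean value theorem with a density below 1. The bound later dominates the difference
  quotients of \<open>skew_acc\<close> in the slope.\<close>

lemma Phi_lipschitz: "\<bar>Phi x - Phi y\<bar> \<le> \<bar>x - y\<bar>"
proof -
  have "Phi x - Phi y \<le> x - y" if less: "y < x" for x y
  proof -
    obtain z where "Phi x - Phi y = (x - y) * std_normal_density z"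
      using MVT2[of y x Phi std_normal_density, OF less Phi_has_derivative] by blast
    also have "\<dots> \<le> (x - y) * 1"
      using less std_normal_density_le_half[of z] by (intro mult_left_mono) auto
    finally show ?thesis by simp
  qed
  from this[of x y] this[of y x] show ?thesis
    using Phi_mono[of x y] Phi_mono[of y x] by (cases "x < y"; cases "y < x") auto
qed

text \<open>A zero integral would force the nonnegative f to vanish almost everywhere, which an
  interval of positive length excludes. Strict inequalities between integrals come from
  here.\<close>

lemma integral_pos_Icc:
  fixes f :: "real \<Rightarrow> real"
  assumes f: "integrable lborel f" and nonneg: "\<And>x. 0 \<le> f x"
    and pos: "\<And>x. x \<in> {a..b} \<Longrightarrow> 0 < f x" and "a < b"
  shows "0 < integral\<^sup>L lborel f"
proof -
  have "integral\<^sup>L lborel f \<noteq> 0"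
  proof
    assume "integral\<^sup>L lborel f = 0"
    then have "AE x in lborel. f x = 0"
      using integral_nonneg_eq_0_iff_AE[OF f] nonneg by simp
    then have "AE x in lborel. x \<notin> {a..b}"
      by (rule eventually_mono) (use pos in force)
    then have "emeasure lborel {a..b} = 0"
      by (subst (asm) AE_iff_measurable[OF _ refl]) (auto simp: atLeastAtMost_def atLeast_def atMost_def Int_def)
    then show False using \<open>a < b\<close> by simp
  qed
  moreover have "0 \<le> integral\<^sup>L lborel f"
    using nonneg by simp
  ultimately show ?thesis by simp
qed

subsection \<open>The maximum of a bivariate normal pair\<close>

text \<open>The slope k of the skew-normal law of the maximum. This form of it is visibly continuous
  up to \<rho> = 1, where it takes the value 0.\<close>

definition corr_slope :: "real \<Rightarrow> real" where
  "corr_slope \<rho> = sqrt ((1 - \<rho>) / (1 + \<rho>))"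

lemma corr_slope_eq:
  assumes "-1 < \<rho>" "\<rho> < 1"
  shows "(1 - \<rho>) / sqrt (1 - \<rho>\<^sup>2) = corr_slope \<rho>"
proof -
  have "sqrt (1 - \<rho>\<^sup>2) = sqrt (1 - \<rho>) * sqrt (1 + \<rho>)"
    by (simp add: real_sqrt_mult[symmetric] power2_eq_square algebra_simps)
  moreover have "1 - \<rho> = sqrt (1 - \<rho>) * sqrt (1 - \<rho>)" using assms by simp
  moreover have "sqrt (1 - \<rho>) \<noteq> 0" "sqrt (1 + \<rho>) \<noteq> 0" using assms by auto
  ultimately have "(1 - \<rho>) / sqrt (1 - \<rho>\<^sup>2) = sqrt (1 - \<rho>) * sqrt (1 - \<rho>) / (sqrt (1 - \<rho>) * sqrt (1 + \<rho>))"
    by metis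
  also have "\<dots> = sqrt (1 - \<rho>) / sqrt (1 + \<rho>)"
    using \<open>sqrt (1 - \<rho>) \<noteq> 0\<close> by (rule mult_divide_mult_cancel_left)
  finally show ?thesis
    by (simp add: corr_slope_def real_sqrt_divide)
qed

text \<open>Up to the factor \<open>1 / \<sigma>\<close>, both sides are a marginal density times a
  conditional density. Multiplied by \<open>\<sigma>\<^sup>2\<close>, each sum of squares in the
  exponent becomes \<open>x\<^sup>2 - 2 * \<rho> * x * w + w\<^sup>2\<close>, which is symmetric in
  x and w.\<close>

lemma bvn_density_sym:
  fixes \<rho> x w :: real
  assumes "\<sigma> = sqrt (1 - \<rho>\<^sup>2)" "-1 < \<rho>" "\<rho> < 1"
  shows "std_normal_density x * std_normal_density ((w - \<rho> * x) / \<sigma>)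
       = std_normal_density w * std_normal_density ((x - \<rho> * w) / \<sigma>)"
proof -
  have "\<rho>\<^sup>2 < 1" using assms by (simp add: abs_square_less_1)
  then have s: "\<sigma>\<^sup>2 = 1 - \<rho>\<^sup>2" "\<sigma>\<^sup>2 \<noteq> 0" using assms by auto
  have "x\<^sup>2 + ((w - \<rho> * x) / \<sigma>)\<^sup>2 = w\<^sup>2 + ((x - \<rho> * w) / \<sigma>)\<^sup>2"
  proof -
    have "\<sigma>\<^sup>2 * x\<^sup>2 + (w - \<rho> * x)\<^sup>2 = \<sigma>\<^sup>2 * w\<^sup>2 + (x - \<rho> * w)\<^sup>2"
      unfolding s by (simp add: power2_eq_square algebra_simps)
    then show ?thesis using s(2) by (simp add: power_divide field_simps)
  qed
  then have "exp (- x\<^sup>2 / 2) * exp (- ((w - \<rho> * x) / \<sigma>)\<^sup>2 / 2) = exp (- w\<^sup>2 / 2) * exp (- ((x - \<rho> * w) / \<sigma>)\<^sup>2 / 2)"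
    by (simp add: mult_exp_exp add_divide_distrib[symmetric])
  then show ?thesis by (simp add: std_normal_density_def)
qed

text \<open>The maximum of a \<open>BVN(\<rho>)\<close> pair is skew-normal: on \<open>{Z\<^sub>2 \<le> Z\<^sub>1}\<close> condition on \<open>Z\<^sub>1\<close>, and the
  other half is equal to it by exchangeability.\<close>

lemma nn_integral_bvn_max:
  fixes h :: "real \<Rightarrow> ennreal"
  assumes \<rho>: "-1 < \<rho>" "\<rho> < 1" and [measurable]: "h \<in> borel_measurable borel"
  shows "(\<integral>\<^sup>+z. h (max (fst z) (snd z)) \<partial>bvn \<rho>)
       = (\<integral>\<^sup>+s. h s * ennreal (2 * std_normal_density s * Phi (corr_slope \<rho> * s)) \<partial>lborel)"
proof -
  define \<sigma> where "\<sigma> = sqrt (1 - \<rho>\<^sup>2)"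
  have "\<rho>\<^sup>2 < 1" using \<rho> by (simp add: abs_square_less_1)
  then have \<sigma>: "\<sigma> > 0" by (simp add: \<sigma>_def)
  interpret N: prob_space std_normal by (rule prob_space_std_normal)
  interpret NN: pair_sigma_finite std_normal std_normal by unfold_locales
  \<comment> \<open>The joint density of the pair at (x, w): the marginal density of x times the
    conditional density of w.\<close>
  define p where "p x w = std_normal_density x * (std_normal_density ((w - \<rho> * x) / \<sigma>) / \<sigma>)" for x w
  have p_sym: "p x w = p w x" for x w
    using bvn_density_sym[OF \<sigma>_def \<rho>, of x w] by (simp add: p_def)
  have p_eq: "ennreal (p x w) = ennreal (std_normal_density x) * ennreal (std_normal_density ((w - \<rho> * x) / \<sigma>) / \<sigma>)" for x w
    unfolding p_def using \<sigma> by (intro ennreal_mult) auto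
  have [measurable]: "(\<lambda>(x, w). p x w) \<in> borel_measurable (borel \<Otimes>\<^sub>M borel)"
    unfolding p_def by measurable
  have [measurable]: "(\<lambda>(x, y). (x, \<rho> * x + \<sigma> * y)) \<in> std_normal \<Otimes>\<^sub>M std_normal \<rightarrow>\<^sub>M borel"
    by (simp add: borel_prod[symmetric])
  have half: "(\<integral>\<^sup>+w. h x * ennreal (p x w) * indicator {..x} w \<partial>lborel)
      = h x * ennreal (std_normal_density x * Phi (corr_slope \<rho> * x))" for x
  proof -
    have "(\<integral>\<^sup>+w. h x * ennreal (p x w) * indicator {..x} w \<partial>lborel)
       = (\<integral>\<^sup>+w. (h x * ennreal (std_normal_density x)) * (ennreal (std_normal_density ((w - \<rho> * x) / \<sigma>) / \<sigma>) * indicator {..x} w) \<partial>lborel)"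
      by (intro nn_integral_cong) (simp only: p_eq mult.assoc)
    also have "\<dots> = h x * ennreal (std_normal_density x) * ennreal (Phi ((x - \<rho> * x) / \<sigma>))"
      by (subst nn_integral_cmult) (simp_all add: nn_integral_std_normal_affine_atMost[OF \<sigma>])
    also have "(x - \<rho> * x) / \<sigma> = (1 - \<rho>) / \<sigma> * x" by (simp add: algebra_simps)
    also have "(1 - \<rho>) / \<sigma> = corr_slope \<rho>" unfolding \<sigma>_def by (rule corr_slope_eq[OF \<rho>])
    finally show ?thesis by (simp add: ennreal_mult Phi_nonneg mult.assoc)
  qed
  have "(\<integral>\<^sup>+z. h (max (fst z) (snd z)) \<partial>bvn \<rho>)
     = (\<integral>\<^sup>+z. h (max (fst z) (\<rho> * fst z + \<sigma> * snd z)) \<partial>(std_normal \<Otimes>\<^sub>M std_normal))"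
    unfolding bvn_def \<sigma>_def[symmetric]
    by (subst nn_integral_distr) (auto simp: borel_prod[symmetric] case_prod_beta)
  also have "\<dots> = (\<integral>\<^sup>+x. \<integral>\<^sup>+y. h (max x (\<rho> * x + \<sigma> * y)) \<partial>std_normal \<partial>std_normal)"
    by (subst N.nn_integral_fst[symmetric]) auto
  also have "\<dots> = (\<integral>\<^sup>+x. ennreal (std_normal_density x) * (\<integral>\<^sup>+y. ennreal (std_normal_density y) * h (max x (\<rho> * x + \<sigma> * y)) \<partial>lborel) \<partial>lborel)"
    unfolding std_normal_def by (simp add: nn_integral_density)
  also have "\<dots> = (\<integral>\<^sup>+x. \<integral>\<^sup>+w. ennreal (p x w) * h (max x w) \<partial>lborel \<partial>lborel)"
  proof (intro nn_integral_cong)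
    fix x :: real
    \<comment> \<open>Change of variable \<open>y = (w - \<rho> * x) / \<sigma>\<close>, which
      replaces the independent second coordinate by the correlated one.\<close>
    have "(\<integral>\<^sup>+y. ennreal (std_normal_density y) * h (max x (\<rho> * x + \<sigma> * y)) \<partial>lborel)
      = ennreal \<bar>1 / \<sigma>\<bar> * (\<integral>\<^sup>+w. ennreal (std_normal_density (- \<rho> * x / \<sigma> + 1 / \<sigma> * w)) * h (max x (\<rho> * x + \<sigma> * (- \<rho> * x / \<sigma> + 1 / \<sigma> * w))) \<partial>lborel)"
      using \<sigma> by (intro nn_integral_real_affine) auto
    also have "\<dots> = ennreal \<bar>1 / \<sigma>\<bar> * (\<integral>\<^sup>+w. ennreal (std_normal_density ((w - \<rho> * x) / \<sigma>)) * h (max x w) \<partial>lborel)"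
    proof -
      have "- \<rho> * x / \<sigma> + 1 / \<sigma> * w = (w - \<rho> * x) / \<sigma>" "\<rho> * x + \<sigma> * ((w - \<rho> * x) / \<sigma>) = w" for w
        using \<sigma> by (simp_all add: field_simps)
      then show ?thesis by simp
    qed
    finally have "ennreal (std_normal_density x) * (\<integral>\<^sup>+y. ennreal (std_normal_density y) * h (max x (\<rho> * x + \<sigma> * y)) \<partial>lborel)
      = (\<integral>\<^sup>+w. ennreal (std_normal_density x) * (ennreal \<bar>1 / \<sigma>\<bar> * (ennreal (std_normal_density ((w - \<rho> * x) / \<sigma>)) * h (max x w))) \<partial>lborel)"
      by (simp add: nn_integral_cmult)
    also have "\<dots> = (\<integral>\<^sup>+w. ennreal (p x w) * h (max x w) \<partial>lborel)"
    proof (intro nn_integral_cong)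
      fix w
      have "ennreal \<bar>1 / \<sigma>\<bar> * ennreal (std_normal_density ((w - \<rho> * x) / \<sigma>)) = ennreal (std_normal_density ((w - \<rho> * x) / \<sigma>) / \<sigma>)"
        using \<sigma> by (subst ennreal_mult[symmetric]) auto
      then have "ennreal (p x w) = ennreal (std_normal_density x) * (ennreal \<bar>1 / \<sigma>\<bar> * ennreal (std_normal_density ((w - \<rho> * x) / \<sigma>)))"
        by (simp only: p_eq)
      then show "ennreal (std_normal_density x) * (ennreal \<bar>1 / \<sigma>\<bar> * (ennreal (std_normal_density ((w - \<rho> * x) / \<sigma>)) * h (max x w)))
         = ennreal (p x w) * h (max x w)"
        by (simp add: mult.assoc)
    qed
    finally show "ennreal (std_normal_density x) * (\<integral>\<^sup>+y. ennreal (std_normal_density y) * h (max x (\<rho> * x + \<sigma> * y)) \<partial>lborel) = \<dots>" .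
  qed
  \<comment> \<open>The plane splits into the two triangles on either side of the diagonal. Both
    indicators count w = x, but for fixed x this is one null point.\<close>
  also have "\<dots> = (\<integral>\<^sup>+x. (\<integral>\<^sup>+w. h x * ennreal (p x w) * indicator {..x} w + h w * ennreal (p x w) * indicator {..w} x \<partial>lborel) \<partial>lborel)"
  proof (rule nn_integral_cong, rule nn_integral_cong_AE)
    fix x :: real
    show "AE w in lborel. ennreal (p x w) * h (max x w) = h x * ennreal (p x w) * indicator {..x} w + h w * ennreal (p x w) * indicator {..w} x"
      using AE_lborel_singleton[of x]
      by eventually_elim (auto simp: indicator_def max_def mult.commute)
  qed
  also have "\<dots> = (\<integral>\<^sup>+x. (\<integral>\<^sup>+w. h x * ennreal (p x w) * indicator {..x} w \<partial>lborel) + (\<integral>\<^sup>+w. h w * ennreal (p x w) * indicator {..w} x \<partial>lborel) \<partial>lborel)"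
    by (intro nn_integral_cong nn_integral_add) (auto simp: p_def indicator_def)
  also have "\<dots> = (\<integral>\<^sup>+x. (\<integral>\<^sup>+w. h x * ennreal (p x w) * indicator {..x} w \<partial>lborel) \<partial>lborel)
      + (\<integral>\<^sup>+x. (\<integral>\<^sup>+w. h w * ennreal (p x w) * indicator {..w} x \<partial>lborel) \<partial>lborel)"
    by (intro nn_integral_add) (auto simp: p_def indicator_def)
  \<comment> \<open>Swapping the order makes the larger coordinate the outer variable; by symmetry
    of p the second triangle then contributes the same as the first.\<close>
  also have "(\<integral>\<^sup>+x. (\<integral>\<^sup>+w. h w * ennreal (p x w) * indicator {..w} x \<partial>lborel) \<partial>lborel)
     = (\<integral>\<^sup>+w. (\<integral>\<^sup>+x. h w * ennreal (p x w) * indicator {..w} x \<partial>lborel) \<partial>lborel)"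
    by (rule lborel_pair.Fubini') (auto simp: p_def indicator_def)
  also have "\<dots> = (\<integral>\<^sup>+w. (\<integral>\<^sup>+x. h w * ennreal (p w x) * indicator {..w} x \<partial>lborel) \<partial>lborel)"
    by (subst p_sym) simp
  finally have "(\<integral>\<^sup>+z. h (max (fst z) (snd z)) \<partial>bvn \<rho>)
      = (\<integral>\<^sup>+x. h x * ennreal (std_normal_density x * Phi (corr_slope \<rho> * x)) \<partial>lborel)
      + (\<integral>\<^sup>+x. h x * ennreal (std_normal_density x * Phi (corr_slope \<rho> * x)) \<partial>lborel)"
    by (simp add: half)
  also have "\<dots> = (\<integral>\<^sup>+x. h x * ennreal (std_normal_density x * Phi (corr_slope \<rho> * x)) + h x * ennreal (std_normal_density x * Phi (corr_slope \<rho> * x)) \<partial>lborel)"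
    by (intro nn_integral_add[symmetric]) auto
  also have "\<dots> = (\<integral>\<^sup>+s. h s * ennreal (2 * std_normal_density s * Phi (corr_slope \<rho> * s)) \<partial>lborel)"
    by (intro nn_integral_cong)
       (simp add: distrib_left[symmetric] ennreal_plus[symmetric] Phi_nonneg mult_ac del: ennreal_plus)
  finally show ?thesis .
qed

subsection \<open>The expected acceptance probability\<close>

definition accept :: "real \<Rightarrow> real \<Rightarrow> real" where
  "accept l s = min 1 (exp (- l * s - l\<^sup>2 / 2))"

text \<open>Completing the square shows this to be the pointwise minimum of the densities of N(0,1)
  and N(-l,1), which cross at \<open>- l / 2\<close>.\<close>

definition acc_weight :: "real \<Rightarrow> real \<Rightarrow> real" where
  "acc_weight l s = std_normal_density s * accept l s"

text \<open>The expected acceptance as a function of the slope. At slope 0 the factor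
  \<open>2 * Phi (k * s)\<close> is 1, so \<open>skew_acc l 0\<close> is the total mass of
  \<open>acc_weight l\<close> and serves as the constant multiplying v in the equation.\<close>

definition skew_acc :: "real \<Rightarrow> real \<Rightarrow> real" where
  "skew_acc l k = (\<integral>s. acc_weight l s * (2 * Phi (k * s)) \<partial>lborel)"

lemma accept_pos: "0 < accept l s" by (simp add: accept_def)

lemma accept_le_1: "accept l s \<le> 1" by (simp add: accept_def)

lemma accept_left: "0 < l \<Longrightarrow> s \<le> - l / 2 \<Longrightarrow> accept l s = 1"
  using mult_left_mono[of s "- l / 2" l] by (simp add: accept_def power2_eq_square)

lemma accept_right: "0 < l \<Longrightarrow> - l / 2 \<le> s \<Longrightarrow> accept l s = exp (- l * s - l\<^sup>2 / 2)"
  using mult_left_mono[of "- l / 2" s l] by (simp add: accept_def power2_eq_square min_def)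

lemma borel_measurable_accept [measurable]: "accept l \<in> borel_measurable borel"
  unfolding accept_def by measurable

lemma borel_measurable_acc_weight [measurable]: "acc_weight l \<in> borel_measurable borel"
  unfolding acc_weight_def by measurable

lemma acc_weight_pos: "0 < acc_weight l s"
  by (simp add: acc_weight_def accept_pos normal_density_pos)

lemma acc_weight_le: "acc_weight l s \<le> std_normal_density s"
  using mult_left_mono[OF accept_le_1, of "std_normal_density s" l s] by (simp add: acc_weight_def)

lemma acc_weight_left: "0 < l \<Longrightarrow> s \<le> - l / 2 \<Longrightarrow> acc_weight l s = std_normal_density s"
  by (simp add: acc_weight_def accept_left)

lemma acc_weight_right: "0 < l \<Longrightarrow> - l / 2 \<le> s \<Longrightarrow> acc_weight l s = std_normal_density (s + l)"
proof -
  have "- s\<^sup>2 / 2 + (- l * s - l\<^sup>2 / 2) = - (s + l)\<^sup>2 / 2"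
    by (simp add: power2_eq_square field_simps)
  then show "0 < l \<Longrightarrow> - l / 2 \<le> s \<Longrightarrow> acc_weight l s = std_normal_density (s + l)"
    by (simp add: acc_weight_def accept_right std_normal_density_def mult_exp_exp)
qed

lemma integrable_acc_weight_mult:
  assumes [measurable]: "f \<in> borel_measurable borel" and "\<And>s. \<bar>f s\<bar> \<le> B"
  shows "integrable lborel (\<lambda>s. acc_weight l s * f s)"
proof (rule Bochner_Integration.integrable_bound)
  show "integrable lborel (\<lambda>s. B * std_normal_density s)" by simp
  show "AE s in lborel. norm (acc_weight l s * f s) \<le> norm (B * std_normal_density s)"
  proof (intro AE_I2)
    fix s
    have "\<bar>acc_weight l s * f s\<bar> \<le> std_normal_density s * B"
      unfolding abs_mult using acc_weight_le acc_weight_pos[of l s] assms(2)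
      by (intro mult_mono) auto
    moreover have "0 \<le> B" using assms(2)[of s] by linarith
    ultimately show "norm (acc_weight l s * f s) \<le> norm (B * std_normal_density s)"
      by (simp add: abs_mult mult.commute)
  qed
qed simp

lemma integrable_acc_weight: "integrable lborel (acc_weight l)"
  using integrable_acc_weight_mult[of "\<lambda>_. 1" 1 l] by simp

lemma integrable_acc_weight_Phi: "integrable lborel (\<lambda>s. acc_weight l s * (2 * Phi (k * s)))"
  by (rule integrable_acc_weight_mult[where B=2]) (auto simp: Phi_nonneg Phi_le_1)

lemma integrable_acc_weight_abs: "integrable lborel (\<lambda>s. acc_weight l s * \<bar>s\<bar>)"
proof (rule Bochner_Integration.integrable_bound)
  show "integrable lborel (\<lambda>s. std_normal_density s * \<bar>s\<bar>)"
    using integrable_std_normal_moment_abs[of 1] by simp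
  show "AE s in lborel. norm (acc_weight l s * \<bar>s\<bar>) \<le> norm (std_normal_density s * \<bar>s\<bar>)"
    using acc_weight_le acc_weight_pos[THEN less_imp_le] by (intro AE_I2) (simp add: abs_mult mult_right_mono)
qed simp

text \<open>The half-line left of \<open>- l / 2\<close> carries the normal mass
  \<open>Phi (- l / 2)\<close>; the other half-line, after a shift by l, carries the mass right of
  \<open>l / 2\<close>, which is the same by symmetry.\<close>

lemma integral_acc_weight:
  assumes "0 < l"
  shows "integral\<^sup>L lborel (acc_weight l) = 2 * Phi (- l / 2)"
proof -
  have "integral\<^sup>L lborel (acc_weight l)
      = (\<integral>s. std_normal_density s * indicator {..-l/2} s + std_normal_density (l + s) * indicator {-l/2<..} s \<partial>lborel)"
    using assms by (intro Bochner_Integration.integral_cong) (auto simp: indicator_def acc_weight_left acc_weight_right add.commute)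
  also have "\<dots> = (\<integral>s. std_normal_density s * indicator {..-l/2} s \<partial>lborel) + (\<integral>s. std_normal_density (l + s) * indicator {-l/2<..} s \<partial>lborel)"
  proof (intro Bochner_Integration.integral_add integrable_indicator_density)
    have "integrable lborel (\<lambda>s. std_normal_density (l + 1 * s))"
      by (intro lborel_integrable_real_affine) auto
    then show "integrable lborel (\<lambda>s. std_normal_density (l + s) * indicator {-l/2<..} s)"
      using integrable_mult_indicator[of "{-l/2<..}" lborel "\<lambda>s. std_normal_density (l + s)"] by (simp add: mult.commute)
  qed simp
  also have "(\<integral>s. std_normal_density (l + s) * indicator {-l/2<..} s \<partial>lborel)
      = (\<integral>s. std_normal_density s * indicator {l/2<..} s \<partial>lborel)"
    by (subst (2) lborel_integral_real_affine[where c=1 and t=l]) (auto intro!: Bochner_Integration.integral_cong simp: indicator_def)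
  also have "\<dots> = (\<integral>s. std_normal_density s - std_normal_density s * indicator {..l/2} s \<partial>lborel)"
    by (intro Bochner_Integration.integral_cong) (auto simp: indicator_def)
  also have "\<dots> = 1 - Phi (l / 2)"
    unfolding Phi_eq_integral by (subst Bochner_Integration.integral_diff) (auto intro: integrable_indicator_density)
  also have "\<dots> = Phi (- l / 2)" using Phi_minus[of "l / 2"] by simp
  finally show ?thesis unfolding Phi_eq_integral[symmetric] by simp
qed

lemma skew_acc_0: "skew_acc l 0 = integral\<^sup>L lborel (acc_weight l)"
  by (simp add: skew_acc_def Phi_0)

text \<open>For positive l both exponentials decrease, so the smaller one belongs to the larger
  coordinate: only the maximum of the pair matters.\<close>

lemma acc_max:
  assumes "0 < l"
  shows "min 1 (min (exp (- l * x - l\<^sup>2 / 2)) (exp (- l * y - l\<^sup>2 / 2))) = accept l (max x y)"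
  using assms by (auto simp: accept_def min_def max_def)

lemma prob_space_bvn: "prob_space (bvn \<rho>)"
proof -
  interpret N: prob_space std_normal by (rule prob_space_std_normal)
  interpret NN: pair_prob_space std_normal std_normal by unfold_locales
  show ?thesis
    unfolding bvn_def by (rule NN.prob_space_distr) (simp add: borel_prod[symmetric])
qed

lemma sets_bvn [simp, measurable_cong]: "sets (bvn \<rho>) = sets borel"
  by (simp add: bvn_def)

lemma borel_measurable_accept_bvn [measurable]:
  "(\<lambda>z. accept l (max (fst z) (snd z))) \<in> borel_measurable (bvn \<rho>)"
proof -
  have "(\<lambda>z. accept l (max (fst z) (snd z))) \<in> borel_measurable (borel \<Otimes>\<^sub>M borel)" by measurable
  then show ?thesis by (simp add: borel_prod)
qed

lemma integral_bvn_accept: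
  assumes "0 < l" "-1 < \<rho>" "\<rho> \<le> 1"
  shows "(\<integral>z. accept l (max (fst z) (snd z)) \<partial>bvn \<rho>) = skew_acc l (corr_slope \<rho>)"
proof (cases "\<rho> = 1")
  \<comment> \<open>The law now sits on the diagonal and has no joint density, so the second
    coordinate is integrated out directly. The slope is 0, which matches the general
    formula.\<close>
  case True
  interpret N: prob_space std_normal by (rule prob_space_std_normal)
  interpret NN: pair_prob_space std_normal std_normal by unfold_locales
  have meas: "(\<lambda>(x, y). (x, 1 * x + sqrt (1 - 1\<^sup>2) * y)) \<in> std_normal \<Otimes>\<^sub>M std_normal \<rightarrow>\<^sub>M borel"
    by (simp add: borel_prod[symmetric])
  have "(\<integral>z. accept l (max (fst z) (snd z)) \<partial>bvn \<rho>) = (\<integral>z. accept l (fst z) \<partial>(std_normal \<Otimes>\<^sub>M std_normal))"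
    unfolding True bvn_def
    by (subst integral_distr[OF meas]) (auto simp: borel_prod[symmetric] case_prod_beta)
  also have "\<dots> = (\<integral>x. \<integral>y. accept l x \<partial>std_normal \<partial>std_normal)"
    by (subst NN.integral_fst'[symmetric])
       (auto intro!: NN.P.integrable_const_bound[where B=1] simp: accept_le_1 accept_pos less_imp_le)
  also have "\<dots> = (\<integral>x. accept l x \<partial>std_normal)"
    using N.prob_space by simp
  also have "\<dots> = integral\<^sup>L lborel (acc_weight l)"
    unfolding std_normal_def acc_weight_def[abs_def] by (subst integral_density) auto
  finally show ?thesis using True by (simp add: skew_acc_0 corr_slope_def)
next
  case False
  then have \<rho>: "-1 < \<rho>" "\<rho> < 1" using assms by auto
  have "(\<integral>z. accept l (max (fst z) (snd z)) \<partial>bvn \<rho>)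
     = enn2real (\<integral>\<^sup>+z. ennreal (accept l (max (fst z) (snd z))) \<partial>bvn \<rho>)"
    by (intro integral_eq_nn_integral) (auto simp: accept_pos less_imp_le)
  also have "\<dots> = enn2real (\<integral>\<^sup>+s. ennreal (accept l s) * ennreal (2 * std_normal_density s * Phi (corr_slope \<rho> * s)) \<partial>lborel)"
    by (subst nn_integral_bvn_max[OF \<rho>]) auto
  also have "\<dots> = enn2real (\<integral>\<^sup>+s. ennreal (acc_weight l s * (2 * Phi (corr_slope \<rho> * s))) \<partial>lborel)"
    by (intro arg_cong[where f=enn2real] nn_integral_cong)
       (simp add: ennreal_mult[symmetric] accept_pos less_imp_le Phi_nonneg acc_weight_def mult_ac)
  also have "\<dots> = skew_acc l (corr_slope \<rho>)"
    unfolding skew_acc_def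
    by (intro integral_eq_nn_integral[symmetric]) (auto simp: acc_weight_pos less_imp_le Phi_nonneg)
  finally show ?thesis .
qed

lemma Fgen_eq:
  assumes "0 < l" "-1 < \<rho>" "\<rho> \<le> 1"
  shows "Fgen l \<rho> v = skew_acc l (corr_slope \<rho>) - v * skew_acc l 0"
  using assms unfolding Fgen_def acc_max[OF assms(1)]
  by (simp add: integral_bvn_accept skew_acc_0 integral_acc_weight)

text \<open>The integrand is strictly positive and the subtracted term is not. Arguing on
  \<open>bvn \<rho>\<close> itself also covers \<rho> = -1, which the skew-normal formula does not
  reach; all v \<le> 0 are thereby excluded as zeros.\<close>

lemma Fgen_pos:
  assumes "0 < l" "v \<le> 0"
  shows "0 < Fgen l \<rho> v"
proof -
  interpret prob_space "bvn \<rho>" by (rule prob_space_bvn)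
  have int: "integrable (bvn \<rho>) (\<lambda>z. accept l (max (fst z) (snd z)))"
    by (intro integrable_const_bound[where B=1]) (auto simp: accept_le_1 accept_pos less_imp_le)
  have "(\<integral>z. accept l (max (fst z) (snd z)) \<partial>bvn \<rho>) \<noteq> 0"
  proof
    assume "(\<integral>z. accept l (max (fst z) (snd z)) \<partial>bvn \<rho>) = 0"
    then have "AE z in bvn \<rho>. accept l (max (fst z) (snd z)) = 0"
      by (subst (asm) integral_nonneg_eq_0_iff_AE[OF int]) (auto simp: accept_pos less_imp_le)
    then have "AE z in bvn \<rho>. False"
      by (rule AE_mp) (auto simp: accept_pos less_imp_neq[OF accept_pos, symmetric])
    then show False by simp
  qed
  moreover have "0 \<le> (\<integral>z. accept l (max (fst z) (snd z)) \<partial>bvn \<rho>)"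
    by (intro Bochner_Integration.integral_nonneg) (auto simp: accept_pos less_imp_le)
  moreover have "v * Phi (- l / 2) \<le> 0"
    using assms(2) by (intro mult_nonpos_nonneg Phi_nonneg)
  ultimately show ?thesis
    unfolding Fgen_def acc_max[OF assms(1)] by simp
qed

subsection \<open>Differentiation in the slope\<close>

text \<open>Differentiation under the integral sign, by dominated convergence along sequences; the
  Lipschitz bound on \<open>Phi\<close> gives the majorant
  \<open>2 * (acc_weight l s * \<bar>s\<bar>)\<close>.\<close>

lemma DERIV_skew_acc_aux:
  "(skew_acc l has_real_derivative (\<integral>s. acc_weight l s * (2 * (std_normal_density (k * s) * s)) \<partial>lborel)) (at k)"
  unfolding DERIV_def tendsto_at_iff_sequentially
proof (intro allI impI)
  fix X :: "nat \<Rightarrow> real"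
  assume X0: "\<forall>i. X i \<in> UNIV - {0}" and X: "X \<longlonglongrightarrow> 0"
  let ?q = "\<lambda>i s. acc_weight l s * (2 * ((Phi ((k + X i) * s) - Phi (k * s)) / X i))"
  have eq: "((\<lambda>h. (skew_acc l (k + h) - skew_acc l k) / h) \<circ> X) = (\<lambda>i. integral\<^sup>L lborel (?q i))"
  proof
    fix i
    have "skew_acc l (k + X i) - skew_acc l k
       = (\<integral>s. acc_weight l s * (2 * Phi ((k + X i) * s)) - acc_weight l s * (2 * Phi (k * s)) \<partial>lborel)"
      unfolding skew_acc_def
      by (intro Bochner_Integration.integral_diff[symmetric] integrable_acc_weight_Phi)
    then have "(skew_acc l (k + X i) - skew_acc l k) / X i
       = (\<integral>s. (acc_weight l s * (2 * Phi ((k + X i) * s)) - acc_weight l s * (2 * Phi (k * s))) / X i \<partial>lborel)"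
      by simp
    also have "\<dots> = integral\<^sup>L lborel (?q i)"
      by (intro Bochner_Integration.integral_cong) (auto simp: diff_divide_distrib algebra_simps)
    finally show "((\<lambda>h. (skew_acc l (k + h) - skew_acc l k) / h) \<circ> X) i = integral\<^sup>L lborel (?q i)" by simp
  qed
  show "((\<lambda>h. (skew_acc l (k + h) - skew_acc l k) / h) \<circ> X) \<longlonglongrightarrow> (\<integral>s. acc_weight l s * (2 * (std_normal_density (k * s) * s)) \<partial>lborel)"
    unfolding eq
  proof (rule integral_dominated_convergence)
    show "integrable lborel (\<lambda>s. 2 * (acc_weight l s * \<bar>s\<bar>))"
      using integrable_acc_weight_abs by simp
    show "AE s in lborel. (\<lambda>i. ?q i s) \<longlonglongrightarrow> acc_weight l s * (2 * (std_normal_density (k * s) * s))"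
    proof (rule AE_I2)
      fix s
      have "((\<lambda>k. Phi (k * s)) has_real_derivative std_normal_density (k * s) * s) (at k)"
        by (auto intro!: derivative_eq_intros)
      then have "((\<lambda>h. (Phi ((k + h) * s) - Phi (k * s)) / h) \<circ> X) \<longlonglongrightarrow> std_normal_density (k * s) * s"
        unfolding DERIV_def tendsto_at_iff_sequentially using X0 X by blast
      then show "(\<lambda>i. ?q i s) \<longlonglongrightarrow> acc_weight l s * (2 * (std_normal_density (k * s) * s))"
        by (intro tendsto_intros) (simp add: o_def)
    qed
    show "AE s in lborel. norm (?q i s) \<le> 2 * (acc_weight l s * \<bar>s\<bar>)" for i
    proof (rule AE_I2)
      fix s
      have "\<bar>Phi ((k + X i) * s) - Phi (k * s)\<bar> \<le> \<bar>X i\<bar> * \<bar>s\<bar>"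
        using Phi_lipschitz[of "(k + X i) * s" "k * s"] by (simp add: algebra_simps abs_mult)
      then have "\<bar>(Phi ((k + X i) * s) - Phi (k * s)) / X i\<bar> \<le> \<bar>s\<bar>"
        using X0 by (simp add: field_simps)
      then have "acc_weight l s * (2 * \<bar>(Phi ((k + X i) * s) - Phi (k * s)) / X i\<bar>) \<le> acc_weight l s * (2 * \<bar>s\<bar>)"
        using acc_weight_pos[of l s] by (intro mult_left_mono) auto
      moreover have "norm (?q i s) = acc_weight l s * (2 * \<bar>(Phi ((k + X i) * s) - Phi (k * s)) / X i\<bar>)"
        using acc_weight_pos[of l s] by (simp only: real_norm_def abs_mult abs_of_pos abs_numeral)
      ultimately show "norm (?q i s) \<le> 2 * (acc_weight l s * \<bar>s\<bar>)" by (metis mult.left_commute)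
    qed
  qed measurable
qed

section \<open>Integration by parts across the kink of the acceptance function\<close>

text \<open>The fundamental theorem on each side of a possible kink a: the boundary values F a from
  the two sides cancel by continuity, and those at infinity are 0.\<close>

lemma integral_derivative_eq_0:
  fixes F f :: "real \<Rightarrow> real"
  assumes F: "\<And>x. x \<noteq> a \<Longrightarrow> (F has_real_derivative f x) (at x)" "isCont F a"
    and f: "\<And>x. x \<noteq> a \<Longrightarrow> isCont f x" "integrable lborel f"
    and lim: "(F \<longlongrightarrow> 0) at_bot" "(F \<longlongrightarrow> 0) at_top"
  shows "integral\<^sup>L lborel f = 0"
proof -
  have int: "set_integrable lborel A f" if "A \<in> sets borel" for A
    using f(2) that unfolding set_integrable_def by (intro integrable_mult_indicator) auto
  have left: "(LBINT x=-\<infinity>..a. f x) = F a - 0"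
  proof (rule interval_integral_FTC_integrable)
    show "((F \<circ> real_of_ereal) \<longlongrightarrow> F a) (at_left (ereal a))"
      unfolding ereal_tendsto_simps using F(2) by (simp add: isCont_def filterlim_at_split)
    show "((F \<circ> real_of_ereal) \<longlongrightarrow> 0) (at_right (-\<infinity>))"
      using lim by (simp add: ereal_tendsto_simps)
  qed (use F f int in \<open>auto simp: has_real_derivative_iff_has_vector_derivative\<close>)
  have right: "(LBINT x=a..\<infinity>. f x) = 0 - F a"
  proof (rule interval_integral_FTC_integrable)
    show "((F \<circ> real_of_ereal) \<longlongrightarrow> F a) (at_right (ereal a))"
      unfolding ereal_tendsto_simps using F(2) by (simp add: isCont_def filterlim_at_split)
    show "((F \<circ> real_of_ereal) \<longlongrightarrow> 0) (at_left \<infinity>)"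
      using lim by (simp add: ereal_tendsto_simps)
  qed (use F f int in \<open>auto simp: has_real_derivative_iff_has_vector_derivative\<close>)
  have "integral\<^sup>L lborel f = (LBINT x=-\<infinity>..\<infinity>. f x)"
    by (simp add: interval_integral_eq_integral interval_lebesgue_integral_def set_lebesgue_integral_def)
  also have "\<dots> = (LBINT x=-\<infinity>..a. f x) + (LBINT x=a..\<infinity>. f x)"
    by (rule interval_integral_sum[symmetric])
       (use int in \<open>auto simp: interval_lebesgue_integrable_def\<close>)
  finally show ?thesis using left right by simp
qed

text \<open>Multiplying the densities at s and \<open>k * s\<close> gives a Gaussian factor of rate
  \<open>c = 1 + k\<^sup>2\<close>, up to a constant.\<close>

definition tilt :: "real \<Rightarrow> real \<Rightarrow> real \<Rightarrow> real" where
  "tilt l c s = accept l s * exp (- c * s\<^sup>2 / 2)"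

text \<open>The contribution of the derivative of \<open>accept l\<close>, with its sign reversed:
  for l > 0 this derivative is 0 left of the kink \<open>- l / 2\<close> and
  \<open>- l * accept l s\<close> right of it.\<close>

definition tilt_mass :: "real \<Rightarrow> real \<Rightarrow> real" where
  "tilt_mass l c = (\<integral>s. l * (indicator {-l/2..} s * tilt l c s) \<partial>lborel)"

lemma borel_measurable_tilt [measurable]: "tilt l c \<in> borel_measurable borel"
  unfolding tilt_def by measurable

lemma tilt_pos: "0 < tilt l c s" by (simp add: tilt_def accept_pos)

lemma tilt_antimono: "c \<le> d \<Longrightarrow> tilt l d s \<le> tilt l c s"
  by (simp add: tilt_def accept_pos mult_right_mono)

lemma tilt_le:
  assumes "1 \<le> c"
  shows "tilt l c s \<le> sqrt (2 * pi) * std_normal_density s"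
proof -
  have "tilt l c s \<le> tilt l 1 s" using assms by (rule tilt_antimono)
  also have "\<dots> \<le> 1 * exp (- 1 * s\<^sup>2 / 2)"
    unfolding tilt_def by (intro mult_right_mono accept_le_1) simp
  finally show ?thesis by (simp add: std_normal_density_def)
qed

lemma integrable_tilt:
  assumes "1 \<le> c"
  shows "integrable lborel (tilt l c)" "integrable lborel (\<lambda>s. tilt l c s * s)"
proof -
  show "integrable lborel (tilt l c)"
  proof (rule Bochner_Integration.integrable_bound)
    show "integrable lborel (\<lambda>s. sqrt (2 * pi) * std_normal_density s)" by simp
  qed (use tilt_pos[THEN less_imp_le] tilt_le[OF assms] in auto)
  show "integrable lborel (\<lambda>s. tilt l c s * s)"
  proof (rule Bochner_Integration.integrable_bound)
    show "integrable lborel (\<lambda>s. sqrt (2 * pi) * (std_normal_density s * \<bar>s\<bar>))"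
      using integrable_std_normal_moment_abs[of 1] by simp
    show "AE s in lborel. norm (tilt l c s * s) \<le> norm (sqrt (2 * pi) * (std_normal_density s * \<bar>s\<bar>))"
    proof (rule AE_I2)
      fix s
      have "tilt l c s * \<bar>s\<bar> \<le> sqrt (2 * pi) * std_normal_density s * \<bar>s\<bar>"
        by (intro mult_right_mono tilt_le[OF assms]) simp
      then show "norm (tilt l c s * s) \<le> norm (sqrt (2 * pi) * (std_normal_density s * \<bar>s\<bar>))"
        using tilt_pos[of l c s] by (simp add: abs_mult mult.assoc)
    qed
  qed simp
qed

lemma integrable_tilt_indicator:
  "1 \<le> c \<Longrightarrow> integrable lborel (\<lambda>s. l * (indicator {-l/2..} s * tilt l c s))"
  using integrable_mult_indicator[of "{-l/2..}" lborel "tilt l c"] integrable_tilt(1) by simp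

lemma tilt_tendsto_0:
  assumes "1 \<le> c" and F: "filterlim (\<lambda>s::real. s\<^sup>2) at_top F"
  shows "(tilt l c \<longlongrightarrow> 0) F"
proof (rule tendsto_sandwich[of "\<lambda>_. 0"])
  have "filterlim (\<lambda>s::real. - s\<^sup>2 / 2) at_bot F"
    using filterlim_tendsto_pos_mult_at_top[OF tendsto_const[of "1/2"] _ F]
    by (simp add: filterlim_uminus_at_bot)
  then show "((\<lambda>s::real. exp (- s\<^sup>2 / 2)) \<longlongrightarrow> 0) F"
    by (rule filterlim_compose[OF exp_at_bot])
  show "\<forall>\<^sub>F s in F. tilt l c s \<le> exp (- s\<^sup>2 / 2)"
    using tilt_le[OF assms(1)] by (intro always_eventually) (simp add: std_normal_density_def)
qed (auto intro!: always_eventually simp: tilt_pos less_imp_le)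

text \<open>Away from the kink the derivative of \<open>tilt l c\<close> is \<open>?f\<close>: one
  term from the acceptance function, one from the Gaussian factor. Its total integral vanishes, so
  the first moment is expressed by \<open>tilt_mass\<close>.\<close>

lemma integral_tilt_mult:
  assumes "0 < l" "1 \<le> c"
  shows "(\<integral>s. tilt l c s * s \<partial>lborel) = - tilt_mass l c / c"
proof -
  let ?f = "\<lambda>s. - (l * (indicator {-l/2..} s * tilt l c s)) - c * (tilt l c s * s)"
  have gauss: "((\<lambda>s. exp (- c * s\<^sup>2 / 2)) has_real_derivative - c * s * exp (- c * s\<^sup>2 / 2)) (at s)" for s
    by (auto intro!: derivative_eq_intros simp: power2_eq_square)
  have "integral\<^sup>L lborel ?f = 0"
  proof (rule integral_derivative_eq_0[where F="tilt l c" and a="-l/2"])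
    show "(tilt l c has_real_derivative ?f s) (at s)" if "s \<noteq> -l/2" for s
    proof (cases "s < -l/2")
      case True
      have "((\<lambda>s. exp (- c * s\<^sup>2 / 2)) has_real_derivative ?f s) (at s)"
        using gauss[of s] True assms by (simp add: tilt_def accept_left mult_ac)
      moreover have "\<forall>\<^sub>F x in nhds s. x < -l/2"
        using eventually_nhds_in_open[of "{..<-l/2}" s] True by simp
      ultimately show ?thesis
        using assms by (subst DERIV_cong_ev[OF refl _ refl, of _ "\<lambda>s. exp (- c * s\<^sup>2 / 2)"])
          (auto elim!: eventually_mono simp: tilt_def accept_left)
    next
      case False
      then have s: "-l/2 < s" using that by simp
      have "((\<lambda>s. exp (- l * s - l\<^sup>2 / 2) * exp (- c * s\<^sup>2 / 2)) has_real_derivative ?f s) (at s)"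
        using s assms by (auto intro!: derivative_eq_intros gauss simp: tilt_def accept_right algebra_simps)
      moreover have "\<forall>\<^sub>F x in nhds s. -l/2 < x"
        using eventually_nhds_in_open[of "{-l/2<..}" s] s by simp
      ultimately show ?thesis
        using assms by (subst DERIV_cong_ev[OF refl _ refl, of _ "\<lambda>s. exp (- l * s - l\<^sup>2 / 2) * exp (- c * s\<^sup>2 / 2)"])
          (auto elim!: eventually_mono simp: tilt_def accept_right)
    qed
    have cont: "isCont (tilt l c) s" for s
      unfolding tilt_def accept_def by (intro continuous_intros) auto
    then show "isCont (tilt l c) (-l/2)" .
    show "isCont ?f s" if "s \<noteq> -l/2" for s
    proof -
      have "isCont (indicator {-l/2..} :: real \<Rightarrow> real) s"
        using that by (simp add: isCont_indicator frontier_def)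
      then show ?thesis by (intro continuous_intros cont)
    qed
    show "integrable lborel ?f"
      using integrable_tilt_indicator[OF assms(2), of l] integrable_tilt(2)[OF assms(2), of l]
      by (intro Bochner_Integration.integrable_diff) auto
    have "filterlim (\<lambda>s::real. s\<^sup>2) at_top at_top"
      by (intro filterlim_pow_at_top filterlim_ident) auto
    moreover from filterlim_compose[OF this filterlim_uminus_at_top_at_bot]
    have "filterlim (\<lambda>s::real. s\<^sup>2) at_top at_bot" by simp
    ultimately show "(tilt l c \<longlongrightarrow> 0) at_bot" "(tilt l c \<longlongrightarrow> 0) at_top"
      using tilt_tendsto_0[OF assms(2)] by blast+
  qed
  also have "integral\<^sup>L lborel ?f = - tilt_mass l c - c * (\<integral>s. tilt l c s * s \<partial>lborel)"
    unfolding tilt_mass_def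
    using integrable_tilt_indicator[OF assms(2), of l] integrable_tilt(2)[OF assms(2), of l]
    by (subst Bochner_Integration.integral_diff) auto
  finally show ?thesis using assms by (simp add: field_simps)
qed

lemma DERIV_skew_acc:
  assumes "0 < l"
  shows "(skew_acc l has_real_derivative - tilt_mass l (1 + k\<^sup>2) / (pi * (1 + k\<^sup>2))) (at k)"
proof -
  have *: "acc_weight l s * (2 * (std_normal_density (k * s) * s)) = (tilt l (1 + k\<^sup>2) s * s) / pi" for s
  proof -
    have "exp (- s\<^sup>2 / 2) * exp (- (k * s)\<^sup>2 / 2) = exp (- (1 + k\<^sup>2) * s\<^sup>2 / 2)"
      by (simp add: mult_exp_exp algebra_simps power_mult_distrib add_divide_distrib[symmetric] del: add_divide_distrib)
    moreover have "acc_weight l s * (2 * (std_normal_density (k * s) * s))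
       = accept l s * (exp (- s\<^sup>2 / 2) * exp (- (k * s)\<^sup>2 / 2)) * s * (2 * (1 / sqrt (2 * pi) * (1 / sqrt (2 * pi))))"
      unfolding acc_weight_def std_normal_density_def by (simp only: mult_ac)
    moreover have "2 * (1 / sqrt (2 * pi) * (1 / sqrt (2 * pi))) = 1 / pi" by simp
    ultimately have "acc_weight l s * (2 * (std_normal_density (k * s) * s)) = accept l s * exp (- (1 + k\<^sup>2) * s\<^sup>2 / 2) * s * (1 / pi)"
      by (simp only:)
    then show ?thesis by (simp add: tilt_def)
  qed
  have "(\<integral>s. acc_weight l s * (2 * (std_normal_density (k * s) * s)) \<partial>lborel) = - tilt_mass l (1 + k\<^sup>2) / (pi * (1 + k\<^sup>2))"
    unfolding * using integral_tilt_mult[OF assms, of "1 + k\<^sup>2"] by (simp add: mult.commute)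
  then show ?thesis using DERIV_skew_acc_aux[of l k] by simp
qed

lemma tilt_mass_antimono:
  assumes "0 < l" "1 \<le> c" "c \<le> d"
  shows "tilt_mass l d \<le> tilt_mass l c"
  unfolding tilt_mass_def
  using assms tilt_antimono[OF assms(3)]
  by (intro integral_mono integrable_tilt_indicator) (auto simp: indicator_def)

lemma tilt_mass_pos:
  assumes "0 < l" "1 \<le> c"
  shows "0 < tilt_mass l c"
  unfolding tilt_mass_def
proof (rule integral_pos_Icc[where a="-l/2" and b="0"])
  show "integrable lborel (\<lambda>s. l * (indicator {-l/2..} s * tilt l c s))"
    using assms(2) by (rule integrable_tilt_indicator)
  show "0 \<le> l * (indicator {-l/2..} s * tilt l c s)" for s
    using assms tilt_pos[of l c s] by (simp add: indicator_def)
  show "0 < l * (indicator {-l/2..} s * tilt l c s)" if "s \<in> {-l/2..0}" for s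
    using that assms tilt_pos[of l c s] by (simp add: indicator_def)
qed (use assms in simp)

subsection \<open>Dependence on the step size\<close>

lemma accept_antimono:
  assumes "0 < l1" "l1 \<le> l2"
  shows "accept l2 s \<le> accept l1 s"
proof (cases "s \<le> - l1 / 2")
  case True
  then show ?thesis using assms accept_le_1 by (simp add: accept_left)
next
  case False
  \<comment> \<open>This product is exactly the difference of the two exponents.\<close>
  have "0 \<le> (l2 - l1) * (s + (l1 + l2) / 2)"
    using assms False by (intro mult_nonneg_nonneg) (simp_all add: field_simps)
  then have "- l2 * s - l2\<^sup>2 / 2 \<le> - l1 * s - l1\<^sup>2 / 2"
    by (simp add: power2_eq_square field_simps)
  then show ?thesis
    using assms False by (simp add: accept_right)
qed

text \<open>The monotone likelihood ratio property in product form. Left of \<open>- l2 / 2\<close>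
  both values at s are 1 and monotonicity in l suffices. Beyond that point, \<open>accept l2\<close>
  shrinks from s to t by the factor \<open>exp (- l2 * (t - s))\<close>, whereas
  \<open>accept l1\<close> shrinks at most by \<open>exp (- l1 * (t - s))\<close>.\<close>

lemma accept_log_supermodular:
  assumes "0 < l1" "l1 \<le> l2" "s \<le> t"
  shows "accept l2 t * accept l1 s \<le> accept l2 s * accept l1 t"
proof (cases "s \<le> - l2 / 2")
  case True
  then have "accept l2 s = 1" "accept l1 s = 1"
    using assms by (simp_all add: accept_left)
  then show ?thesis using accept_antimono[of l1 l2 t] assms by simp
next
  case False
  have "accept l2 t = accept l2 s * exp (- l2 * (t - s))"
    using assms False by (simp add: accept_right mult_exp_exp algebra_simps)
  moreover have "exp (- l2 * (t - s)) * accept l1 s \<le> accept l1 t"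
  proof (cases "t \<le> - l1 / 2")
    case True
    have "exp (- l2 * (t - s)) * accept l1 s \<le> 1 * 1"
      using assms accept_pos by (intro mult_mono accept_le_1) (auto simp: less_imp_le)
    then show ?thesis using True assms by (simp add: accept_left)
  next
    case t: False
    have le: "l1 * (t - s) \<le> l2 * (t - s)"
      using assms by (intro mult_right_mono) auto
    show ?thesis
    proof (cases "s \<le> - l1 / 2")
      case True
      have "l1 * (t + l1 / 2) \<le> l1 * (t - s)"
        using assms True by (intro mult_left_mono) auto
      then have "- l2 * (t - s) \<le> - l1 * t - l1\<^sup>2 / 2"
        using le by (simp add: algebra_simps power2_eq_square)
      then show ?thesis using assms True t by (simp add: accept_left accept_right)
    next
      case False
      then show ?thesis using assms t le by (simp add: accept_right mult_exp_exp algebra_simps)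
    qed
  qed
  ultimately show ?thesis
    using accept_pos[of l2 s] by (simp add: mult.assoc mult_left_mono less_imp_le)
qed

lemma skew_acc_0_pos: "0 < l \<Longrightarrow> 0 < skew_acc l 0"
  by (simp add: skew_acc_0 integral_acc_weight Phi_pos)

text \<open>The law with density proportional to \<open>acc_weight l\<close> decreases in \<open>l\<close> in the likelihood ratio
  order, and \<open>\<lambda>s. Phi (k * s)\<close> is increasing.  With \<open>K\<close> the quotient of the total masses and \<open>s\<^sub>0\<close> the
  point where the likelihood ratio equals \<open>K\<close>, the function
  \<open>(acc_weight l2 - K * acc_weight l1) * (Phi (k * s) - Phi (k * s\<^sub>0))\<close> is nonpositive.\<close>

lemma skew_acc_ratio_less:
  assumes l: "0 < l1" "l1 < l2" and k: "0 < k"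
  shows "skew_acc l2 k * skew_acc l1 0 < skew_acc l1 k * skew_acc l2 0"
proof -
  have l2: "0 < l2" using l by simp
  define K where "K = skew_acc l2 0 / skew_acc l1 0"
  define q where "q s = accept l2 s / accept l1 s" for s
  have K: "0 < K" "K < 1"
    using skew_acc_0_pos[OF l(1)] skew_acc_0_pos[OF l2] Phi_strict_mono[of "- l2 / 2" "- l1 / 2"] l
    by (simp_all add: K_def skew_acc_0 integral_acc_weight Phi_pos)
  have q_left: "q s = 1" if "s \<le> - l2 / 2" for s
    using that l by (simp add: q_def accept_left)
  have q_antimono: "q t \<le> q s" if "s \<le> t" for s t
    using accept_log_supermodular[of l1 l2 s t] that l accept_pos[of l1 s] accept_pos[of l1 t]
    by (simp add: q_def field_simps)
  \<comment> \<open>Past both kinks the logarithm of q is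
    \<open>- (l2 - l1) * b - (l2\<^sup>2 - l1\<^sup>2) / 2\<close>, so the second entry pushes q
    down to K; the entry 0 keeps b to the right of the kinks.\<close>
  define b where "b = max 0 (- ln K / (l2 - l1))"
  have "q b \<le> K"
  proof -
    have b: "b \<ge> 0" "- ln K / (l2 - l1) \<le> b" by (auto simp: b_def)
    then have "- ln K \<le> (l2 - l1) * b" using l by (simp add: field_simps)
    moreover have "l1\<^sup>2 \<le> l2\<^sup>2" using l by (intro power_mono) auto
    ultimately have le: "- l2 * b - l2\<^sup>2 / 2 - (- l1 * b - l1\<^sup>2 / 2) \<le> ln K"
      by (simp add: algebra_simps)
    have "q b = exp (- l2 * b - l2\<^sup>2 / 2 - (- l1 * b - l1\<^sup>2 / 2))"
      using l b by (simp add: q_def accept_right exp_diff)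
    also have "\<dots> \<le> exp (ln K)" using le by (simp only: exp_le_cancel_iff)
    finally show ?thesis using K by simp
  qed
  moreover have "K \<le> q (- l2 / 2)" using q_left[of "- l2 / 2"] K by simp
  moreover have "- l2 / 2 \<le> b" using l2 by (auto simp: b_def)
  moreover have "continuous_on {- l2 / 2..b} q"
    unfolding q_def accept_def by (intro continuous_intros) (auto simp: min_def)
  ultimately obtain s0 where s0: "q s0 = K"
    using IVT2'[of q b K "- l2 / 2"] by blast
  let ?m = "\<lambda>s. 2 * Phi (k * s)"
  \<comment> \<open>The negative of the function described above, with the factor 2 kept in
    \<open>?m\<close>; hence it is nonnegative.\<close>
  let ?f = "\<lambda>s. (K * acc_weight l1 s - acc_weight l2 s) * (?m s - ?m s0)"
  have w: "K * acc_weight l1 s - acc_weight l2 s = acc_weight l1 s * (q s0 - q s)" for s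
    using accept_pos[of l1 s] by (simp add: acc_weight_def q_def[of s] s0 field_simps)
  have m_mono: "?m s < ?m t" if "s < t" for s t
    using that k Phi_strict_mono by simp
  have f_eq: "?f s = K * (acc_weight l1 s * ?m s) - acc_weight l2 s * ?m s
      - ?m s0 * (K * acc_weight l1 s - acc_weight l2 s)" for s
    by (simp add: algebra_simps)
  have "0 < integral\<^sup>L lborel ?f"
  proof (rule integral_pos_Icc[where a="- l2 / 2 - 1" and b="- l2 / 2"])
    show "integrable lborel ?f"
      unfolding f_eq
      by (intro Bochner_Integration.integrable_diff integrable_mult_right integrable_acc_weight integrable_acc_weight_Phi)
    show "0 \<le> ?f s" for s
    proof (cases "s \<le> s0")
      case True
      then have "q s0 - q s \<le> 0" "?m s - ?m s0 \<le> 0"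
        using q_antimono[of s s0] Phi_mono[of "k * s" "k * s0"] k by auto
      then show ?thesis unfolding w
        using acc_weight_pos[of l1 s] by (metis mult.assoc mult_nonneg_nonneg mult_nonpos_nonpos less_imp_le)
    next
      case False
      then have "0 \<le> q s0 - q s" "0 \<le> ?m s - ?m s0"
        using q_antimono[of s0 s] Phi_mono[of "k * s0" "k * s"] k by auto
      then show ?thesis unfolding w
        using acc_weight_pos[of l1 s] by (intro mult_nonneg_nonneg) auto
    qed
    \<comment> \<open>Here q is still 1 and exceeds K, so s lies left of s0 and both differences are
      strictly negative.\<close>
    show "0 < ?f s" if "s \<in> {- l2 / 2 - 1..- l2 / 2}" for s
    proof -
      have "q s0 < q s" using that q_left[of s] K s0 by simp
      moreover from this have "s < s0" using q_antimono[of s0 s] by force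
      ultimately have "q s0 - q s < 0" "?m s - ?m s0 < 0" using m_mono[of s s0] by auto
      then show ?thesis unfolding w
        using acc_weight_pos[of l1 s] by (metis mult.assoc mult_pos_pos mult_neg_neg)
    qed
  qed simp
  also have "integral\<^sup>L lborel ?f = K * skew_acc l1 k - skew_acc l2 k - ?m s0 * (K * skew_acc l1 0 - skew_acc l2 0)"
    unfolding f_eq skew_acc_0 skew_acc_def[of _ k]
    by (simp only: Bochner_Integration.integral_diff integrable_mult_right integral_mult_right_zero
        integrable_acc_weight integrable_acc_weight_Phi Bochner_Integration.integrable_diff)
  \<comment> \<open>K equalises the total masses, so centring at \<open>?m s0\<close> costs nothing
    in the integral.\<close>
  also have "K * skew_acc l1 0 - skew_acc l2 0 = 0"
    using skew_acc_0_pos[OF l(1)] by (simp add: K_def)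
  finally show ?thesis
    using skew_acc_0_pos[OF l(1)] by (simp add: K_def field_simps)
qed

text \<open>Split at \<open>- l / 4\<close>, halfway between the kink and 0. To the left
  \<open>Phi (k * s)\<close> is at most \<open>Phi (- k * l / 4)\<close>; to the right the weight is
  an exponentially small fraction of the total. After division by \<open>skew_acc l 0\<close> the
  bound vanishes as l grows.\<close>

lemma skew_acc_le:
  assumes l: "0 < l" and k: "0 < k"
  shows "skew_acc l k \<le> (2 * Phi (- k * l / 4) + 2 * exp (- l\<^sup>2 / 8)) * skew_acc l 0"
proof -
  let ?I = "indicator {- l / 4<..} :: real \<Rightarrow> real"
  have int: "integrable lborel (\<lambda>s. acc_weight l s * ?I s)"
    by (rule integrable_acc_weight_mult[where B=1]) (auto simp: indicator_def)
  have "skew_acc l k \<le> (\<integral>s. 2 * Phi (- k * l / 4) * acc_weight l s + 2 * (acc_weight l s * ?I s) \<partial>lborel)"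
    unfolding skew_acc_def
  proof (intro integral_mono integrable_acc_weight_Phi Bochner_Integration.integrable_add integrable_mult_right integrable_acc_weight int)
    fix s
    have "2 * Phi (k * s) \<le> 2 * Phi (- k * l / 4) + 2 * ?I s"
    proof (cases "s \<le> - l / 4")
      case True
      then have "k * s \<le> - k * l / 4" using k mult_left_mono[of s "- l / 4" k] by simp
      then show ?thesis using Phi_mono True by (simp add: indicator_def)
    next
      case False
      then show ?thesis using Phi_le_1[of "k * s"] Phi_nonneg[of "- k * l / 4"] by (simp add: indicator_def)
    qed
    then have "acc_weight l s * (2 * Phi (k * s)) \<le> acc_weight l s * (2 * Phi (- k * l / 4) + 2 * ?I s)"
      using acc_weight_pos[of l s] by (intro mult_left_mono) auto
    then show "acc_weight l s * (2 * Phi (k * s)) \<le> 2 * Phi (- k * l / 4) * acc_weight l s + 2 * (acc_weight l s * ?I s)"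
      by (simp add: algebra_simps)
  qed
  also have "\<dots> = 2 * Phi (- k * l / 4) * skew_acc l 0 + 2 * (\<integral>s. acc_weight l s * ?I s \<partial>lborel)"
    using int by (simp add: integrable_acc_weight skew_acc_0)
  also have "(\<integral>s. acc_weight l s * ?I s \<partial>lborel) \<le> exp (- l\<^sup>2 / 8) * skew_acc l 0"
  proof -
    \<comment> \<open>A shift by \<open>l / 4\<close> carries the half-line right of the kink onto
      the half-line right of \<open>- l / 4\<close>, so the two weights can be compared
      pointwise.\<close>
    have "(\<integral>s. acc_weight l s * ?I s \<partial>lborel) = (\<integral>s. acc_weight l (l / 4 + 1 * s) * ?I (l / 4 + 1 * s) \<partial>lborel)"
      by (subst lborel_integral_real_affine[where c=1 and t="l / 4"]) auto
    also have "\<dots> \<le> (\<integral>s. exp (- l\<^sup>2 / 8) * acc_weight l s \<partial>lborel)"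
    proof (intro integral_mono integrable_mult_right integrable_acc_weight)
      show "integrable lborel (\<lambda>s. acc_weight l (l / 4 + 1 * s) * ?I (l / 4 + 1 * s))"
        using lborel_integrable_real_affine[OF int, of 1 "l / 4"] by simp
      fix s
      show "acc_weight l (l / 4 + 1 * s) * ?I (l / 4 + 1 * s) \<le> exp (- l\<^sup>2 / 8) * acc_weight l s"
      proof (cases "- l / 2 < s")
        case True
        define a where "a = s + l"
        have "l / 2 \<le> a" using True by (simp add: a_def)
        \<comment> \<open>The cross term in the square of \<open>a + l / 4\<close> is thus at least
          \<open>l\<^sup>2 / 4\<close>; halving it in the Gaussian exponent yields the factor
          \<open>exp (- l\<^sup>2 / 8)\<close>.\<close>
        then have "l / 2 * l \<le> a * l" using l by (intro mult_right_mono) auto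
        moreover have "(a + l / 4)\<^sup>2 = a\<^sup>2 + a * l / 2 + l\<^sup>2 / 16"
          by (simp add: power2_eq_square field_simps)
        moreover have "0 \<le> l * l" by simp
        ultimately have "a\<^sup>2 + l\<^sup>2 / 4 \<le> (a + l / 4)\<^sup>2"
          unfolding power2_eq_square by linarith
        then have "exp (- (a + l / 4)\<^sup>2 / 2) \<le> exp (- l\<^sup>2 / 8 + - a\<^sup>2 / 2)" by simp
        then have "std_normal_density (a + l / 4) \<le> exp (- l\<^sup>2 / 8) * std_normal_density a"
          unfolding std_normal_density_def exp_add
          by (simp add: divide_right_mono)
        moreover have "acc_weight l (l / 4 + 1 * s) = std_normal_density (a + l / 4)" "acc_weight l s = std_normal_density a"
          using l True by (simp_all add: acc_weight_right a_def algebra_simps)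
        ultimately show ?thesis using True by (simp add: indicator_def)
      next
        case False
        then show ?thesis using acc_weight_pos[of l s] by (simp add: indicator_def)
      qed
    qed
    finally show ?thesis by (simp add: skew_acc_0)
  qed
  finally show ?thesis by (simp add: algebra_simps)
qed

section \<open>Zeros of a strictly convex function with infinite slope at the right end\<close>

text \<open>The infinite slope and f 1 = 0 make f negative just before 1, so it has an interior zero
  V. Since f' is strictly increasing, f decreases up to its minimiser and increases afterwards,
  which fixes every sign.\<close>

lemma strictly_convex_crossing:
  fixes f f' :: "real \<Rightarrow> real"
  assumes cont: "continuous_on {0..1} f"
    and der: "\<And>x. 0 < x \<Longrightarrow> x < 1 \<Longrightarrow> (f has_real_derivative f' x) (at x)"
    and mono: "\<And>x y. 0 < x \<Longrightarrow> x < y \<Longrightarrow> y < 1 \<Longrightarrow> f' x < f' y"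
    and lim: "filterlim f' at_top (at_left 1)"
    and f0: "0 < f 0" and f1: "f 1 = 0"
  obtains V where "0 < V" "V < 1" "f V = 0" "f' V < 0"
    "\<And>x. 0 \<le> x \<Longrightarrow> x < V \<Longrightarrow> 0 < f x" "\<And>x. V < x \<Longrightarrow> x < 1 \<Longrightarrow> f x < 0"
proof -
  have mvt: "\<exists>z. x < z \<and> z < y \<and> f y - f x = (y - x) * f' z" if xy: "0 \<le> x" "x < y" "y \<le> 1" for x y
  proof -
    have "continuous_on {x..y} f" using xy by (intro continuous_on_subset[OF cont]) auto
    moreover have "f differentiable (at z)" if "x < z" "z < y" for z
      using der[of z] that xy real_differentiable_def by fastforce
    ultimately obtain D z where "x < z" "z < y" "DERIV f z :> D" "f y - f x = (y - x) * D"
      using MVT[of x y f] xy by blast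
    then show ?thesis using DERIV_unique[OF der[of z]] xy by auto
  qed
  obtain b where b: "b < 1" "\<And>y. b < y \<Longrightarrow> y < 1 \<Longrightarrow> 0 < f' y"
    using filterlim_at_top_dense[THEN iffD1, OF lim, rule_format, of 0]
    by (auto simp: eventually_at_left_field)
  define w where "w = (max 0 b + 1) / 2"
  have w: "0 < w" "b < w" "w < 1" using b(1) by (auto simp: w_def max_def)
  obtain z where "w < z" "z < 1" "f 1 - f w = (1 - w) * f' z"
    using mvt[of w 1] w by auto
  moreover from this have "0 < (1 - w) * f' z" using b(2)[of z] w by simp
  ultimately have "f w < 0" using f1 by linarith
  then obtain V where V: "0 \<le> V" "V \<le> w" "f V = 0"
    using IVT2'[of f w 0 0] w f0 continuous_on_subset[OF cont, of "{0..w}"] by auto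
  then have V01: "0 < V" "V < 1" using f0 w by (auto simp: less_le)
  \<comment> \<open>Rolle between the zeros V and 1: \<xi> is the minimiser, with f' negative before
    it and positive after it.\<close>
  obtain \<xi> where \<xi>: "V < \<xi>" "\<xi> < 1" "f' \<xi> = 0"
    using mvt[of V 1] V V01 f1 by auto
  show thesis
  proof
    show "f' V < 0" using mono[of V \<xi>] V01 \<xi> by simp
    show "0 < f x" if x: "0 \<le> x" "x < V" for x
    proof -
      obtain z where z: "x < z" "z < V" "f V - f x = (V - x) * f' z"
        using mvt[of x V] x V01 by auto
      then have "f' z < 0" using mono[of z \<xi>] x \<xi> by simp
      then have "(V - x) * f' z < 0" using x by (simp add: mult_pos_neg)
      then show ?thesis using z V(3) by linarith
    qed
    show "f x < 0" if x: "V < x" "x < 1" for x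
    proof (cases "x \<le> \<xi>")
      case True
      obtain z where z: "V < z" "z < x" "f x - f V = (x - V) * f' z"
        using mvt[of V x] x V01 by auto
      then have "f' z < 0" using mono[of z \<xi>] True V01 \<xi> by simp
      then have "(x - V) * f' z < 0" using x by (simp add: mult_pos_neg)
      then show ?thesis using z V(3) by linarith
    next
      case False
      obtain z where z: "x < z" "z < 1" "f 1 - f x = (1 - x) * f' z"
        using mvt[of x 1] x V01 by auto
      then have "0 < f' z" using mono[of \<xi> z] False V01 \<xi> by simp
      then have "0 < (1 - x) * f' z" using x by simp
      then show ?thesis using z f1 by linarith
    qed
  qed (use V V01 in auto)
qed

subsection \<open>Crossings of the drift\<close>

definition acc_corr :: "real \<Rightarrow> real \<Rightarrow> real" where
  "acc_corr l \<rho> = skew_acc l (corr_slope \<rho>)"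

text \<open>The rate \<open>2 / (1 + \<rho>)\<close> is \<open>1 + k\<^sup>2\<close> for
  \<open>k = corr_slope \<rho>\<close>; the square root is \<open>k * (1 + \<rho>)\<close>.\<close>

definition acc_corr_deriv :: "real \<Rightarrow> real \<Rightarrow> real" where
  "acc_corr_deriv l \<rho> = tilt_mass l (2 / (1 + \<rho>)) / (2 * pi * sqrt (1 - \<rho>\<^sup>2))"

lemma corr_slope_pos: "-1 < \<rho> \<Longrightarrow> \<rho> < 1 \<Longrightarrow> 0 < corr_slope \<rho>"
  by (simp add: corr_slope_def)

lemma DERIV_corr_slope:
  assumes "-1 < \<rho>" "\<rho> < 1"
  shows "(corr_slope has_real_derivative - 1 / (corr_slope \<rho> * (1 + \<rho>)\<^sup>2)) (at \<rho>)"
proof -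
  have q: "((\<lambda>\<rho>. (1 - \<rho>) / (1 + \<rho>)) has_real_derivative - 2 / (1 + \<rho>)\<^sup>2) (at \<rho>)"
  proof -
    have "((\<lambda>\<rho>. (1 - \<rho>) / (1 + \<rho>)) has_real_derivative ((0 - 1) * (1 + \<rho>) - (1 - \<rho>) * (0 + 1)) / ((1 + \<rho>) * (1 + \<rho>))) (at \<rho>)"
      using assms by (intro DERIV_divide DERIV_diff DERIV_add DERIV_const DERIV_ident) auto
    moreover have "(0 - 1) * (1 + \<rho>) - (1 - \<rho>) * (0 + 1) = - 2" by simp
    ultimately show ?thesis by (simp only: power2_eq_square)
  qed
  have "(sqrt has_real_derivative inverse (sqrt ((1 - \<rho>) / (1 + \<rho>))) / 2) (at ((1 - \<rho>) / (1 + \<rho>)))"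
    using assms by (intro DERIV_real_sqrt) simp
  from DERIV_chain2[OF this q]
  have "(corr_slope has_real_derivative inverse (corr_slope \<rho>) / 2 * (- 2 / (1 + \<rho>)\<^sup>2)) (at \<rho>)"
    unfolding corr_slope_def[abs_def] .
  moreover have "inverse c / 2 * (- 2 / p) = - 1 / (c * p)" for c p :: real
    by (cases "c = 0"; cases "p = 0") (simp_all add: field_simps)
  ultimately show ?thesis by (simp only:)
qed

lemma DERIV_acc_corr:
  assumes l: "0 < l" and \<rho>: "-1 < \<rho>" "\<rho> < 1"
  shows "(acc_corr l has_real_derivative acc_corr_deriv l \<rho>) (at \<rho>)"
proof -
  let ?k = "corr_slope \<rho>"
  have k2: "1 + ?k\<^sup>2 = 2 / (1 + \<rho>)"
  proof -
    have "?k\<^sup>2 = (1 - \<rho>) / (1 + \<rho>)" using \<rho> by (simp add: corr_slope_def)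
    then show ?thesis using \<rho> by (simp add: add_divide_eq_iff)
  qed
  have k: "?k * (1 + \<rho>) = sqrt (1 - \<rho>\<^sup>2)"
  proof -
    have "?k * (1 + \<rho>) = (1 - \<rho>\<^sup>2) / sqrt (1 - \<rho>\<^sup>2)"
      unfolding corr_slope_eq[OF \<rho>, symmetric] by (simp add: power2_eq_square algebra_simps)
    moreover have "\<rho>\<^sup>2 \<le> 1" using \<rho> by (simp add: abs_square_le_1)
    ultimately show ?thesis by (simp add: real_div_sqrt)
  qed
  have "(acc_corr l has_real_derivative
      (- tilt_mass l (1 + ?k\<^sup>2) / (pi * (1 + ?k\<^sup>2))) * (- 1 / (?k * (1 + \<rho>)\<^sup>2))) (at \<rho>)"
    unfolding acc_corr_def[abs_def]
    by (rule DERIV_chain2[OF DERIV_skew_acc[OF l] DERIV_corr_slope[OF \<rho>]])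
  also have "(- tilt_mass l (1 + ?k\<^sup>2) / (pi * (1 + ?k\<^sup>2))) * (- 1 / (?k * (1 + \<rho>)\<^sup>2))
     = tilt_mass l (2 / (1 + \<rho>)) / (2 * pi * (?k * (1 + \<rho>)))"
  proof -
    have "(- t / (pi * (2 / p))) * (- 1 / (c * p\<^sup>2)) = t / (2 * pi * (c * p))" if "0 < p" "0 < c" for t p c :: real
      using that by (simp add: divide_simps power2_eq_square)
    then show ?thesis unfolding k2 using \<rho> corr_slope_pos[OF \<rho>] by simp
  qed
  finally show ?thesis unfolding k acc_corr_deriv_def .
qed

lemma tilt_mass_corr_mono:
  assumes "0 < l" "0 \<le> x" "x \<le> y" "y \<le> 1"
  shows "tilt_mass l (2 / (1 + x)) \<le> tilt_mass l (2 / (1 + y))"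
  using assms by (intro tilt_mass_antimono divide_left_mono) auto

text \<open>On [0, 1) the rate \<open>2 / (1 + \<rho>)\<close> falls, so the numerator does not
  decrease, while the denominator strictly decreases. This is the source of convexity in v.\<close>

lemma acc_corr_deriv_strict_mono:
  assumes "0 < l" "0 \<le> x" "x < y" "y < 1"
  shows "acc_corr_deriv l x < acc_corr_deriv l y"
proof -
  have sq: "x\<^sup>2 < y\<^sup>2" "y\<^sup>2 < 1"
    using assms power_strict_mono[of x y 2] by (auto simp: abs_square_less_1)
  have pos: "0 < tilt_mass l (2 / (1 + y))"
    using assms by (intro tilt_mass_pos) auto
  have "acc_corr_deriv l x \<le> tilt_mass l (2 / (1 + y)) / (2 * pi * sqrt (1 - x\<^sup>2))"
    unfolding acc_corr_deriv_def using assms sq by (intro divide_right_mono tilt_mass_corr_mono) auto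
  also have "\<dots> < acc_corr_deriv l y"
    unfolding acc_corr_deriv_def using sq pos by (intro divide_strict_left_mono) auto
  finally show ?thesis .
qed

lemma acc_corr_deriv_pos:
  assumes "0 < l" "0 \<le> x" "x < 1"
  shows "0 < acc_corr_deriv l x"
  unfolding acc_corr_deriv_def using assms
  by (intro divide_pos_pos tilt_mass_pos) (auto simp: abs_square_less_1)

text \<open>The numerator stays above its value \<open>tilt_mass l 2\<close> at \<rho> = 0, so the
  factor \<open>1 / sqrt (1 - \<rho>\<^sup>2)\<close> forces divergence.\<close>

lemma filterlim_acc_corr_deriv:
  assumes l: "0 < l"
  shows "filterlim (acc_corr_deriv l) at_top (at_left 1)"
proof (rule filterlim_at_top_mono)
  let ?c = "tilt_mass l 2 / (2 * pi)"
  have "((\<lambda>x::real. sqrt (1 - x\<^sup>2)) \<longlongrightarrow> sqrt (1 - 1\<^sup>2)) (at_left 1)"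
    by (intro tendsto_intros)
  moreover have "\<forall>\<^sub>F x::real in at_left 1. 0 < sqrt (1 - x\<^sup>2)"
    using eventually_at_left_real[of 0 1] by (rule eventually_mono) (auto simp: abs_square_less_1)
  ultimately have "filterlim (\<lambda>x::real. inverse (sqrt (1 - x\<^sup>2))) at_top (at_left 1)"
    by (intro filterlim_inverse_at_top) auto
  moreover have "0 < ?c" using tilt_mass_pos[OF l, of 2] by simp
  ultimately show "filterlim (\<lambda>x::real. ?c * inverse (sqrt (1 - x\<^sup>2))) at_top (at_left 1)"
    by (intro filterlim_tendsto_pos_mult_at_top[OF tendsto_const])
  show "\<forall>\<^sub>F x in at_left 1. ?c * inverse (sqrt (1 - x\<^sup>2)) \<le> acc_corr_deriv l x"
    using eventually_at_left_real[of 0 1]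
  proof (rule eventually_mono)
    fix x :: real assume x: "x \<in> {0<..<1}"
    then have "x\<^sup>2 < 1" by (simp add: abs_square_less_1)
    moreover have "tilt_mass l 2 \<le> tilt_mass l (2 / (1 + x))"
      using tilt_mass_corr_mono[OF l, of 0 x] x by simp
    ultimately have "tilt_mass l 2 / (2 * pi * sqrt (1 - x\<^sup>2)) \<le> acc_corr_deriv l x"
      unfolding acc_corr_deriv_def by (intro divide_right_mono) auto
    then show "?c * inverse (sqrt (1 - x\<^sup>2)) \<le> acc_corr_deriv l x"
      by (simp add: field_simps)
  qed simp
qed

text \<open>The derivative formula in \<rho> stops short of 1, so continuity there comes from the
  composition: \<open>skew_acc l\<close> is differentiable in the slope everywhere, including slope
  0.\<close>

lemma continuous_on_acc_corr:
  assumes "0 < l"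
  shows "continuous_on {0..1} (acc_corr l)"
proof -
  have "continuous_on UNIV (skew_acc l)"
    using DERIV_skew_acc[OF assms] by (intro continuous_at_imp_continuous_on ballI DERIV_isCont)
  moreover have "continuous_on {0..1} corr_slope"
    unfolding corr_slope_def by (intro continuous_intros) auto
  ultimately show ?thesis
    unfolding acc_corr_def by (rule continuous_on_compose2) auto
qed

lemma acc_corr_strict_mono:
  assumes "0 < l" "0 \<le> x" "x < y" "y \<le> 1"
  shows "acc_corr l x < acc_corr l y"
proof (rule DERIV_pos_imp_increasing_open[OF assms(3)])
  show "\<exists>D. (acc_corr l has_real_derivative D) (at z) \<and> 0 < D" if "x < z" "z < y" for z
    using DERIV_acc_corr[of l z] acc_corr_deriv_pos[of l z] that assms by force
  show "continuous_on {x..y} (acc_corr l)"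
    using assms by (intro continuous_on_subset[OF continuous_on_acc_corr]) auto
qed

lemma acc_corr_1: "acc_corr l 1 = skew_acc l 0"
  by (simp add: acc_corr_def corr_slope_def)

text \<open>The parameter \<open>a\<close> stands for \<open>1 / \<epsilon>\<close>, so that \<open>a = 0\<close> is the CRN coupling and
  \<open>0 < a < 1\<close> the reflection coupling.\<close>

definition drift :: "real \<Rightarrow> real \<Rightarrow> real \<Rightarrow> real" where
  "drift l a v = Fgen l (v + (1 - v) * a) v"

lemma mix_range:
  fixes a v :: real
  assumes "0 \<le> a" "a \<le> 1" "0 \<le> v" "v \<le> 1"
  shows "0 \<le> v + (1 - v) * a" "v + (1 - v) * a \<le> 1"
proof -
  have "(1 - v) * a \<le> (1 - v) * 1" "0 \<le> (1 - v) * a"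
    using assms by (intro mult_left_mono mult_nonneg_nonneg; simp)+
  then show "0 \<le> v + (1 - v) * a" "v + (1 - v) * a \<le> 1" using assms by simp_all
qed

lemma mix_less_1:
  fixes a v :: real
  assumes "a < 1" "v < 1"
  shows "v + (1 - v) * a < 1"
proof -
  have "(1 - v) * a < (1 - v) * 1"
    using assms by (intro mult_strict_left_mono) auto
  then show ?thesis by simp
qed

lemma drift_eq:
  assumes "0 < l" "0 \<le> a" "a \<le> 1" "0 \<le> v" "v \<le> 1"
  shows "drift l a v = acc_corr l (v + (1 - v) * a) - v * skew_acc l 0"
  unfolding drift_def acc_corr_def
  using mix_range[OF assms(2-)] assms(1) by (intro Fgen_eq) linarith+

lemma DERIV_drift:
  assumes "0 < l" "0 \<le> a" "a < 1" "0 < v" "v < 1"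
  shows "(drift l a has_real_derivative
    (1 - a) * acc_corr_deriv l (v + (1 - v) * a) - skew_acc l 0) (at v)"
proof -
  have \<rho>: "-1 < v + (1 - v) * a" "v + (1 - v) * a < 1"
    using mix_range(1)[of a v] mix_less_1[of a v] assms by linarith+
  have "((\<lambda>v. v + (1 - v) * a) has_real_derivative 1 - a) (at v)"
    by (auto intro!: derivative_eq_intros)
  then have "((\<lambda>v. acc_corr l (v + (1 - v) * a) - v * skew_acc l 0) has_real_derivative
      acc_corr_deriv l (v + (1 - v) * a) * (1 - a) - 1 * skew_acc l 0) (at v)"
    by (intro DERIV_diff DERIV_cmult_right DERIV_ident
        DERIV_chain2[where f="acc_corr l" and g="\<lambda>v. v + (1 - v) * a", OF DERIV_acc_corr[OF assms(1) \<rho>]])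
  moreover have "\<forall>\<^sub>F x in nhds v. drift l a x = acc_corr l (x + (1 - x) * a) - x * skew_acc l 0"
    by (rule eventually_mono[OF eventually_nhds_in_open[of "{0<..<1}" v]]) (use assms in \<open>auto simp: drift_eq\<close>)
  ultimately show ?thesis
    using DERIV_cong_ev[OF refl _ refl, of "drift l a" "\<lambda>v. acc_corr l (v + (1 - v) * a) - v * skew_acc l 0" v]
    by (simp add: mult.commute)
qed

lemma drift_1: "0 < l \<Longrightarrow> drift l a 1 = 0"
  using Fgen_eq[of l 1 1] by (simp add: drift_def corr_slope_def)

lemma drift_pos_of_nonpos: "0 < l \<Longrightarrow> v \<le> 0 \<Longrightarrow> 0 < drift l a v"
  unfolding drift_def by (rule Fgen_pos)

lemma filterlim_mix:
  assumes "0 \<le> a" "a < (1::real)"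
  shows "filterlim (\<lambda>v. v + (1 - v) * a) (at_left 1) (at_left 1)"
  unfolding filterlim_at
proof (intro conjI)
  have "((\<lambda>v. v + (1 - v) * a) \<longlongrightarrow> 1 + (1 - 1) * a) (at_left 1)"
    by (intro tendsto_intros)
  then show "((\<lambda>v. v + (1 - v) * a) \<longlongrightarrow> 1) (at_left 1)" by simp
  show "\<forall>\<^sub>F v in at_left 1. v + (1 - v) * a \<in> {..<1} \<and> v + (1 - v) * a \<noteq> 1"
    by (rule eventually_mono[OF eventually_at_left_real[of 0 1]]) (use mix_less_1[OF assms(2)] in force)+
qed

lemma filterlim_drift_deriv_formula:
  assumes "0 < l" "0 \<le> a" "a < 1"
  shows "filterlim (\<lambda>v. (1 - a) * acc_corr_deriv l (v + (1 - v) * a) - skew_acc l 0) at_top (at_left 1)"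
proof -
  have "filterlim (\<lambda>v. (1 - a) * acc_corr_deriv l (v + (1 - v) * a)) at_top (at_left 1)"
    using assms by (intro filterlim_tendsto_pos_mult_at_top[OF tendsto_const]
        filterlim_compose[OF filterlim_acc_corr_deriv filterlim_mix]) auto
  from filterlim_tendsto_add_at_top[OF tendsto_const[of "- skew_acc l 0"] this]
  show ?thesis by simp
qed

text \<open>Since \<open>deriv\<close> is total, its divergence at 1 carries the intended meaning
  only together with differentiability near 1.\<close>

lemma eventually_drift_differentiable:
  assumes "0 < l" "0 \<le> a" "a < 1"
  shows "\<forall>\<^sub>F v in at_left 1. drift l a differentiable (at v)"
  by (rule eventually_mono[OF eventually_at_left_real[of 0 1]])
    (use DERIV_drift[OF assms] in \<open>auto simp: real_differentiable_def\<close>)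

lemma filterlim_deriv_drift:
  assumes "0 < l" "0 \<le> a" "a < 1"
  shows "filterlim (deriv (drift l a)) at_top (at_left 1)"
proof -
  have "\<forall>\<^sub>F v in at_left 1. (1 - a) * acc_corr_deriv l (v + (1 - v) * a) - skew_acc l 0 = deriv (drift l a) v"
    by (rule eventually_mono[OF eventually_at_left_real[of 0 1]])
      (use DERIV_drift[OF assms] in \<open>auto intro!: DERIV_imp_deriv[symmetric]\<close>)
  from filterlim_cong[OF refl refl this] show ?thesis
    using filterlim_drift_deriv_formula[OF assms] by simp
qed

section \<open>The interior zero and its sign pattern\<close>

text \<open>The sign pattern admits at most one such V, so the choice is determined whenever a
  witness exists.\<close>

definition crossing :: "real \<Rightarrow> real \<Rightarrow> real" where
  "crossing l a = (SOME V. 0 < V \<and> V < 1 \<and> drift l a V = 0 \<and>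
     (\<exists>D. (drift l a has_real_derivative D) (at V) \<and> D < 0) \<and>
     (\<forall>x<V. 0 < drift l a x) \<and> (\<forall>x. V < x \<and> x < 1 \<longrightarrow> drift l a x < 0))"

text \<open>On (0, 1) the correlation is affine and increasing in v, so the derivative of the drift
  inherits strict monotonicity and divergence from \<open>acc_corr_deriv\<close>. Positivity for v
  \<le> 0 extends the left half of the sign pattern to all x below the zero.\<close>

lemma crossing:
  assumes "0 < l" "0 \<le> a" "a < 1"
  shows "0 < crossing l a" "crossing l a < 1" "drift l a (crossing l a) = 0"
    "\<exists>D. (drift l a has_real_derivative D) (at (crossing l a)) \<and> D < 0"
    "\<And>x. x < crossing l a \<Longrightarrow> 0 < drift l a x"
    "\<And>x. crossing l a < x \<Longrightarrow> x < 1 \<Longrightarrow> drift l a x < 0"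
proof -
  let ?f' = "\<lambda>v. (1 - a) * acc_corr_deriv l (v + (1 - v) * a) - skew_acc l 0"
  have "continuous_on {0..1} (\<lambda>v. acc_corr l (v + (1 - v) * a) - v * skew_acc l 0)"
    using assms
    by (intro continuous_intros continuous_on_compose2[OF continuous_on_acc_corr]) (auto simp: mix_range)
  then have cont: "continuous_on {0..1} (drift l a)"
    by (rule continuous_on_eq) (use assms in \<open>simp add: drift_eq\<close>)
  have mono: "?f' x < ?f' y" if "0 < x" "x < y" "y < 1" for x y
  proof -
    have "x + (1 - x) * a < y + (1 - y) * a"
      using assms that mult_strict_right_mono[of x y "1 - a"] by (simp add: algebra_simps)
    then have "acc_corr_deriv l (x + (1 - x) * a) < acc_corr_deriv l (y + (1 - y) * a)"
      using mix_range(1)[of a x] mix_less_1[of a y] that assms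
      by (intro acc_corr_deriv_strict_mono) linarith+
    then show ?thesis using assms by simp
  qed
  obtain V where V: "0 < V" "V < 1" "drift l a V = 0" "?f' V < 0"
    "\<And>x. 0 \<le> x \<Longrightarrow> x < V \<Longrightarrow> 0 < drift l a x" "\<And>x. V < x \<Longrightarrow> x < 1 \<Longrightarrow> drift l a x < 0"
    by (rule strictly_convex_crossing[OF cont DERIV_drift[OF assms] mono filterlim_drift_deriv_formula[OF assms]
          drift_pos_of_nonpos[OF assms(1)] drift_1[OF assms(1)]]) auto
  have "0 < drift l a x" if "x < V" for x
    using V(5)[of x] drift_pos_of_nonpos[OF assms(1), of x a] that by (cases "0 \<le> x") auto
  then have "\<exists>V. 0 < V \<and> V < 1 \<and> drift l a V = 0 \<and>
     (\<exists>D. (drift l a has_real_derivative D) (at V) \<and> D < 0) \<and>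
     (\<forall>x<V. 0 < drift l a x) \<and> (\<forall>x. V < x \<and> x < 1 \<longrightarrow> drift l a x < 0)"
    using V DERIV_drift[OF assms V(1,2)] by blast
  from someI_ex[OF this, folded crossing_def]
  show "0 < crossing l a" "crossing l a < 1" "drift l a (crossing l a) = 0"
    "\<exists>D. (drift l a has_real_derivative D) (at (crossing l a)) \<and> D < 0"
    "\<And>x. x < crossing l a \<Longrightarrow> 0 < drift l a x"
    "\<And>x. crossing l a < x \<Longrightarrow> x < 1 \<Longrightarrow> drift l a x < 0"
    by blast+
qed

lemma drift_zeros:
  assumes "0 < l" "0 \<le> a" "a < 1"
  shows "{v \<in> {-1..1}. drift l a v = 0} = {crossing l a, 1}"
proof (intro equalityI subsetI)
  fix v assume v: "v \<in> {v \<in> {-1..1}. drift l a v = 0}"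
  then show "v \<in> {crossing l a, 1}"
    using crossing(5,6)[OF assms, of v] by (cases "v = 1"; cases v "crossing l a" rule: linorder_cases) auto
qed (use crossing(1,2,3)[OF assms] drift_1[OF assms(1)] in auto)

text \<open>The test-point criterion: the sign of the drift at x tells on which side of the interior
  zero x lies. This and its counterpart \<open>crossing_less\<close> reduce order and limit
  statements about the zero to signs of the drift.\<close>

lemma less_crossing:
  assumes "0 < l" "0 \<le> a" "a < 1" "x < 1" "0 < drift l a x"
  shows "x < crossing l a"
  using crossing(3,6)[OF assms(1-3)] assms(4,5) by (metis less_asym less_irrefl linorder_less_linear)

lemma crossing_less:
  assumes "0 < l" "0 \<le> a" "a < 1" "drift l a x < 0"
  shows "crossing l a < x"
  using crossing(3,5)[OF assms(1-3)] assms(4) by (metis less_asym less_irrefl linorder_less_linear)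

section \<open>Monotonicity and limits of the interior zero\<close>

text \<open>At the zero for a, passing to b raises the correlation and hence the acceptance term,
  while the subtracted term stays fixed; the drift for b is therefore positive there.\<close>

lemma crossing_strict_mono:
  assumes l: "0 < l" and a: "0 \<le> a" "a < b" "b < 1"
  shows "crossing l a < crossing l b"
proof (rule less_crossing[OF l])
  define x where "x = crossing l a"
  have x: "0 < x" "x < 1" "drift l a x = 0"
    using crossing(1-3)[of l a] assms by (simp_all add: x_def)
  have "x + (1 - x) * a < x + (1 - x) * b" using x a by simp
  then have "acc_corr l (x + (1 - x) * a) < acc_corr l (x + (1 - x) * b)"
    using mix_range(1)[of a x] mix_range(2)[of b x] x a l by (intro acc_corr_strict_mono) linarith+
  moreover have "drift l a x = acc_corr l (x + (1 - x) * a) - x * skew_acc l 0"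
    "drift l b x = acc_corr l (x + (1 - x) * b) - x * skew_acc l 0"
    using x a l by (intro drift_eq; linarith)+
  ultimately show "0 < drift l b (crossing l a)"
    using x(3) unfolding x_def[symmetric] by linarith
  show "crossing l a < 1" using x by (simp add: x_def)
qed (use a in auto)

text \<open>At the zero x for l1, the quotient of \<open>skew_acc l1 ?k\<close> by
  \<open>skew_acc l1 0\<close> equals x. The correlation depends on x and a only, so ?k is unchanged
  for l2, where the quotient is smaller and the drift negative.\<close>

lemma crossing_antimono_step:
  assumes l: "0 < l1" "l1 < l2" and a: "0 \<le> a" "a < 1"
  shows "crossing l2 a < crossing l1 a"
proof (rule crossing_less)
  define x where "x = crossing l1 a"
  have x: "0 < x" "x < 1" "drift l1 a x = 0"
    using crossing(1-3)[of l1 a] assms by (simp_all add: x_def)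
  let ?k = "corr_slope (x + (1 - x) * a)"
  have l2: "0 < l2" using l by simp
  have "0 < ?k"
    using mix_range(1)[of a x] mix_less_1[of a x] x a by (intro corr_slope_pos) linarith+
  from skew_acc_ratio_less[OF l this]
  have "skew_acc l2 ?k * skew_acc l1 0 < skew_acc l1 ?k * skew_acc l2 0" .
  moreover have drift: "drift l b v = skew_acc l (corr_slope (v + (1 - v) * b)) - v * skew_acc l 0"
    if "0 < l" "0 \<le> b" "b < 1" "0 < v" "v < 1" for l b v
    using drift_eq[of l b v] that by (simp add: acc_corr_def)
  ultimately have "skew_acc l2 ?k * skew_acc l1 0 < (x * skew_acc l2 0) * skew_acc l1 0"
    using drift[OF l(1) a x(1,2)] x(3) by (simp add: mult_ac)
  then have "skew_acc l2 ?k < x * skew_acc l2 0"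
    using skew_acc_0_pos[OF l(1)] by (rule mult_right_less_imp_less[OF _ less_imp_le])
  then show "drift l2 a (crossing l1 a) < 0"
    using drift[OF l2 a x(1,2)] unfolding x_def[symmetric] by linarith
qed (use a l in auto)

lemma continuous_on_drift_param:
  assumes "0 < l" "0 \<le> x" "x \<le> 1"
  shows "continuous_on {0..1} (\<lambda>a. drift l a x)"
proof -
  have "continuous_on {0..1} (\<lambda>a. acc_corr l (x + (1 - x) * a) - x * skew_acc l 0)"
    using assms
    by (intro continuous_intros continuous_on_compose2[OF continuous_on_acc_corr]) (auto intro: mix_range)
  then show ?thesis
    by (rule continuous_on_eq) (use assms in \<open>simp add: drift_eq\<close>)
qed

text \<open>At a = 1 the correlation is 1 and the drift at x is
  \<open>(1 - x) * skew_acc l 0\<close>, positive for x < 1; continuity in a preserves the sign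
  nearby.\<close>

lemma crossing_tendsto_left:
  assumes l: "0 < l"
  shows "(crossing l \<longlongrightarrow> 1) (at_left 1)"
proof (rule order_tendstoI)
  fix c :: real assume "c < 1"
  define x where "x = max c (1/2)"
  have x: "0 < x" "x < 1" "c \<le> x" using \<open>c < 1\<close> by (auto simp: x_def)
  have "((\<lambda>a. drift l a x) \<longlongrightarrow> drift l 1 x) (at 1 within {0..1})"
    using continuous_on_drift_param[OF l, of x] x by (simp add: continuous_on_def)
  moreover have "0 < drift l 1 x"
    using x l skew_acc_0_pos[OF l] by (simp add: drift_eq acc_corr_1)
  ultimately have "\<forall>\<^sub>F a in at_left 1. 0 < drift l a x"
    using order_tendstoD(1)[of "\<lambda>a. drift l a x"] by (simp add: at_within_Icc_at_left)
  moreover have "\<forall>\<^sub>F a in at_left 1. a \<in> {0<..<1::real}"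
    by (rule eventually_at_left_real) simp
  ultimately show "\<forall>\<^sub>F a in at_left 1. c < crossing l a"
  proof eventually_elim
    case (elim a)
    then show ?case using less_crossing[OF l, of a x] x by simp
  qed
next
  fix c :: real assume "1 < c"
  have "\<forall>\<^sub>F a in at_left 1. a \<in> {0<..<1::real}"
    by (rule eventually_at_left_real) simp
  then show "\<forall>\<^sub>F a in at_left 1. crossing l a < c"
  proof eventually_elim
    case (elim a)
    then show ?case using crossing(2)[OF l, of a] \<open>1 < c\<close> by simp
  qed
qed

text \<open>Monotonicity in a gives the lower bound; for the upper bound, the negative sign of the
  drift at a test point persists from a = 0 to small a.\<close>

lemma crossing_tendsto_right:
  assumes l: "0 < l"
  shows "(crossing l \<longlongrightarrow> crossing l 0) (at_right 0)"
proof (rule order_tendstoI)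
  have ev: "\<forall>\<^sub>F a in at_right 0. a \<in> {0<..<1::real}"
    by (rule eventually_at_right_real) simp
  fix c :: real
  show "\<forall>\<^sub>F a in at_right 0. c < crossing l a" if "c < crossing l 0"
    using ev
  proof eventually_elim
    case (elim a)
    then show ?case using crossing_strict_mono[OF l, of 0 a] that by simp
  qed
  assume "crossing l 0 < c"
  \<comment> \<open>A test point strictly between the zero at a = 0 and both c and 1, where the
    drift for a = 0 is negative.\<close>
  define x where "x = (crossing l 0 + min c 1) / 2"
  have V: "0 < crossing l 0" "crossing l 0 < 1" using crossing(1,2)[OF l, of 0] by auto
  then have x: "0 < x" "x < 1" "x < c" "crossing l 0 < x"
    using \<open>crossing l 0 < c\<close> by (auto simp: x_def min_def)
  have "((\<lambda>a. drift l a x) \<longlongrightarrow> drift l 0 x) (at 0 within {0..1})"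
    using continuous_on_drift_param[OF l, of x] x by (simp add: continuous_on_def)
  moreover have "drift l 0 x < 0"
    using crossing(6)[OF l, of 0 x] x by simp
  ultimately have "\<forall>\<^sub>F a in at_right 0. drift l a x < 0"
    using order_tendstoD(2)[of "\<lambda>a. drift l a x"] by (simp add: at_within_Icc_at_right)
  then show "\<forall>\<^sub>F a in at_right 0. crossing l a < c"
    using ev
  proof eventually_elim
    case (elim a)
    then show ?case using crossing_less[OF l, of a x] x by simp
  qed
qed

text \<open>The acceptance probability tends to 1 pointwise and is bounded by 1, and
  \<open>2 * Phi 0\<close> is 1.\<close>

lemma Fgen_tendsto_0: "((\<lambda>l. Fgen l \<rho> v) \<longlongrightarrow> 1 - v) (at_right 0)"
proof -
  interpret prob_space "bvn \<rho>" by (rule prob_space_bvn)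
  have "((\<lambda>l. \<integral>z. accept l (max (fst z) (snd z)) \<partial>bvn \<rho>) \<longlongrightarrow> (\<integral>z. 1 \<partial>bvn \<rho>)) (at_right 0)"
    unfolding tendsto_at_iff_sequentially
  proof (intro allI impI)
    fix X :: "nat \<Rightarrow> real" assume X: "X \<longlonglongrightarrow> 0"
    show "((\<lambda>l. \<integral>z. accept l (max (fst z) (snd z)) \<partial>bvn \<rho>) \<circ> X) \<longlonglongrightarrow> (\<integral>z. 1 \<partial>bvn \<rho>)"
      unfolding comp_def
    proof (rule integral_dominated_convergence[where w="\<lambda>_. 1"])
      show "AE z in bvn \<rho>. (\<lambda>i. accept (X i) (max (fst z) (snd z))) \<longlonglongrightarrow> 1"
      proof (rule AE_I2)
        fix z :: "real \<times> real"
        have "(\<lambda>i. accept (X i) (max (fst z) (snd z))) \<longlonglongrightarrow> min 1 (exp (- 0 * max (fst z) (snd z) - 0\<^sup>2 / 2))"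
          unfolding accept_def by (intro tendsto_intros X) auto
        then show "(\<lambda>i. accept (X i) (max (fst z) (snd z))) \<longlonglongrightarrow> 1" by simp
      qed
    qed (auto simp: accept_le_1 accept_pos less_imp_le)
  qed
  moreover have "((\<lambda>l. 2 * v * Phi (- l / 2)) \<longlongrightarrow> 2 * v * Phi (- 0 / 2)) (at_right 0)"
    by (intro tendsto_intros) auto
  ultimately have "((\<lambda>l. (\<integral>z. accept l (max (fst z) (snd z)) \<partial>bvn \<rho>) - 2 * v * Phi (- l / 2))
      \<longlongrightarrow> (\<integral>z. 1 \<partial>bvn \<rho>) - 2 * v * Phi (- 0 / 2)) (at_right 0)"
    by (rule tendsto_diff)
  then have "((\<lambda>l. (\<integral>z. accept l (max (fst z) (snd z)) \<partial>bvn \<rho>) - 2 * v * Phi (- l / 2)) \<longlongrightarrow> 1 - v) (at_right 0)"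
    using prob_space by (simp add: Phi_0)
  moreover have "\<forall>\<^sub>F l in at_right 0. (\<integral>z. accept l (max (fst z) (snd z)) \<partial>bvn \<rho>) - 2 * v * Phi (- l / 2) = Fgen l \<rho> v"
    using eventually_at_right_less[of 0]
    by (rule eventually_mono) (simp only: Fgen_def acc_max)
  ultimately show ?thesis by (rule Lim_transform_eventually)
qed

text \<open>At a fixed c < 1 the drift tends to 1 - c > 0, so c eventually lies left of the
  zero.\<close>

lemma crossing_tendsto_1:
  assumes a: "0 \<le> a" "a < 1"
  shows "((\<lambda>l. crossing l a) \<longlongrightarrow> 1) (at_right 0)"
proof (rule order_tendstoI)
  have ev: "\<forall>\<^sub>F l in at_right 0. 0 < (l::real)" by (rule eventually_at_right_less)
  fix c :: real
  show "\<forall>\<^sub>F l in at_right 0. crossing l a < c" if "1 < c"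
    using ev
  proof eventually_elim
    case (elim l)
    show ?case using crossing(2)[OF elim a] that by simp
  qed
  assume "c < 1"
  have "\<forall>\<^sub>F l in at_right 0. 0 < drift l a c"
    unfolding drift_def using Fgen_tendsto_0 \<open>c < 1\<close> by (intro order_tendstoD(1)) auto
  then show "\<forall>\<^sub>F l in at_right 0. c < crossing l a"
    using ev
  proof eventually_elim
    case (elim l)
    show ?case using less_crossing[OF elim(2) a \<open>c < 1\<close> elim(1)] .
  qed
qed

text \<open>With the test point x fixed, the slope k does not vary with l, so the bound of
  \<open>skew_acc_le\<close> on the normalised acceptance eventually drops below x and the drift at
  x becomes negative.\<close>

lemma crossing_tendsto_0:
  assumes a: "0 \<le> a" "a < 1"
  shows "((\<lambda>l. crossing l a) \<longlongrightarrow> 0) at_top"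
proof (rule order_tendstoI)
  have ev: "\<forall>\<^sub>F l in at_top. 0 < (l::real)" by (rule eventually_gt_at_top)
  fix c :: real
  show "\<forall>\<^sub>F l in at_top. c < crossing l a" if "c < 0"
    using ev
  proof eventually_elim
    case (elim l)
    show ?case using crossing(1)[OF elim a] that by simp
  qed
  assume "0 < c"
  define x where "x = min c (1/2)"
  have x: "0 < x" "x < 1" "x \<le> c" using \<open>0 < c\<close> by (auto simp: x_def)
  define k where "k = corr_slope (x + (1 - x) * a)"
  have k: "0 < k" unfolding k_def
    using mix_range(1)[of a x] mix_less_1[of a x] x a by (intro corr_slope_pos) linarith+
  have "((\<lambda>l::real. 2 * Phi (- k * l / 4) + 2 * exp (- l\<^sup>2 / 8)) \<longlongrightarrow> 2 * 0 + 2 * 0) at_top"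
  proof (intro tendsto_add tendsto_mult tendsto_const)
    have "filterlim (\<lambda>l. - (k / 4 * l)) at_bot at_top"
      unfolding filterlim_uminus_at_bot minus_minus
      by (intro filterlim_tendsto_pos_mult_at_top[OF tendsto_const] filterlim_ident) (use k in simp)
    from filterlim_compose[OF Phi_at_bot this] show "((\<lambda>l. Phi (- k * l / 4)) \<longlongrightarrow> 0) at_top" by simp
    have "filterlim (\<lambda>l::real. l\<^sup>2) at_top at_top" by (intro filterlim_pow_at_top filterlim_ident) auto
    then have "filterlim (\<lambda>l::real. - (1 / 8 * l\<^sup>2)) at_bot at_top"
      by (simp only: filterlim_uminus_at_bot minus_minus) (intro filterlim_tendsto_pos_mult_at_top[OF tendsto_const], auto)
    from filterlim_compose[OF exp_at_bot this] show "((\<lambda>l::real. exp (- l\<^sup>2 / 8)) \<longlongrightarrow> 0) at_top" by simp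
  qed
  then have "\<forall>\<^sub>F l in at_top. 2 * Phi (- k * l / 4) + 2 * exp (- l\<^sup>2 / 8) < x"
    using x(1) by (intro order_tendstoD(2)) auto
  then show "\<forall>\<^sub>F l in at_top. crossing l a < c"
    using ev
  proof eventually_elim
    case (elim l)
    have "skew_acc l k \<le> (2 * Phi (- k * l / 4) + 2 * exp (- l\<^sup>2 / 8)) * skew_acc l 0"
      using skew_acc_le[OF elim(2) k] .
    also have "\<dots> < x * skew_acc l 0"
      using elim(1) skew_acc_0_pos[OF elim(2)] by (rule mult_strict_right_mono)
    finally have "drift l a x < 0"
      using elim x a by (simp add: drift_eq acc_corr_def k_def)
    then show ?case using crossing_less[OF elim(2) a, of x] x(3) by simp
  qed
qed

section \<open>The three couplings as instances of the drift\<close>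

lemma F_crn_eq_drift: "F_crn l = drift l 0"
  by (simp add: F_crn_def drift_def fun_eq_iff)

lemma F_refl_eq_drift: "F_refl l \<epsilon> = drift l (1 / \<epsilon>)"
  by (simp add: F_refl_def drift_def fun_eq_iff)

lemma F_gcrn_eq: "0 < l \<Longrightarrow> F_gcrn l v = (1 - v) * skew_acc l 0"
  using Fgen_eq[of l 1 v] by (simp add: F_gcrn_def corr_slope_def algebra_simps)

lemma inverse_of_greater_1:
  fixes \<epsilon> :: real
  assumes "1 < \<epsilon>"
  shows "0 \<le> 1 / \<epsilon>" "0 < 1 / \<epsilon>" "1 / \<epsilon> < 1"
  using assms by simp_all

text \<open>Translates \<epsilon> decreasing to 1 into the parameter \<open>1 / \<epsilon>\<close>
  increasing to 1 from below, the side on which \<open>crossing\<close> is controlled.\<close>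

lemma filterlim_inverse_at_right_1: "filterlim (\<lambda>\<epsilon>::real. 1 / \<epsilon>) (at_left 1) (at_right 1)"
  unfolding filterlim_at
proof (intro conjI)
  have "((\<lambda>\<epsilon>::real. 1 / \<epsilon>) \<longlongrightarrow> 1 / 1) (at_right 1)"
    by (intro tendsto_intros) auto
  then show "((\<lambda>\<epsilon>::real. 1 / \<epsilon>) \<longlongrightarrow> 1) (at_right 1)" by simp
  show "\<forall>\<^sub>F \<epsilon> in at_right 1. 1 / \<epsilon> \<in> {..<1::real} \<and> 1 / \<epsilon> \<noteq> 1"
    by (rule eventually_mono[OF eventually_at_right_less[of 1]]) auto
qed

lemma filterlim_inverse_at_top_0: "filterlim (\<lambda>\<epsilon>::real. 1 / \<epsilon>) (at_right 0) at_top"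
  using filterlim_inverse_at_right_top by (simp add: inverse_eq_divide)

theorem theorem3:
  shows "(\<forall>l1>0. {v\<in>{-1..1}. F_gcrn l1 v = 0} = {1}
             \<and> (\<exists>D. (F_gcrn l1 has_real_derivative D) (at 1) \<and> D < 0))
   \<and> (\<exists>vcrn :: real \<Rightarrow> real. \<exists>vrefl :: real \<Rightarrow> real \<Rightarrow> real.
      (\<forall>l1>0.
          vcrn l1 \<in> {0<..<1}
        \<and> {v\<in>{-1..1}. F_crn l1 v = 0} = {vcrn l1, 1}
        \<and> (\<exists>D. (F_crn l1 has_real_derivative D) (at (vcrn l1)) \<and> D < 0)
        \<and> (\<forall>\<^sub>F v in at_left 1. F_crn l1 differentiable (at v))
        \<and> filterlim (deriv (F_crn l1)) at_top (at_left 1))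
    \<and> (\<forall>l1>0. \<forall>\<epsilon>>1.
          vrefl l1 \<epsilon> \<in> {vcrn l1<..<1}
        \<and> {v\<in>{-1..1}. F_refl l1 \<epsilon> v = 0} = {vrefl l1 \<epsilon>, 1}
        \<and> (\<exists>D. (F_refl l1 \<epsilon> has_real_derivative D) (at (vrefl l1 \<epsilon>)) \<and> D < 0)
        \<and> (\<forall>\<^sub>F v in at_left 1. F_refl l1 \<epsilon> differentiable (at v))
        \<and> filterlim (deriv (F_refl l1 \<epsilon>)) at_top (at_left 1))
    \<and> (\<forall>l1>0. (\<forall>\<epsilon>1 \<epsilon>2. 1 < \<epsilon>1 \<longrightarrow> \<epsilon>1 < \<epsilon>2 \<longrightarrow> vrefl l1 \<epsilon>2 < vrefl l1 \<epsilon>1)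
        \<and> (vrefl l1 \<longlongrightarrow> 1) (at_right 1)
        \<and> (vrefl l1 \<longlongrightarrow> vcrn l1) at_top)
    \<and> (\<forall>l1 l2. 0 < l1 \<longrightarrow> l1 < l2 \<longrightarrow> vcrn l2 < vcrn l1)
    \<and> (\<forall>\<epsilon>>1. \<forall>l1 l2. 0 < l1 \<longrightarrow> l1 < l2 \<longrightarrow> vrefl l2 \<epsilon> < vrefl l1 \<epsilon>)
    \<and> (vcrn \<longlongrightarrow> 1) (at_right 0) \<and> (vcrn \<longlongrightarrow> 0) at_top
    \<and> (\<forall>\<epsilon>>1. ((\<lambda>l1. vrefl l1 \<epsilon>) \<longlongrightarrow> 1) (at_right 0)
              \<and> ((\<lambda>l1. vrefl l1 \<epsilon>) \<longlongrightarrow> 0) at_top))"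
proof (intro conjI)
  show "\<forall>l1>0. {v\<in>{-1..1}. F_gcrn l1 v = 0} = {1}
      \<and> (\<exists>D. (F_gcrn l1 has_real_derivative D) (at 1) \<and> D < 0)"
  proof (intro allI impI conjI)
    fix l :: real assume l: "0 < l"
    note pos = skew_acc_0_pos[OF l]
    show "{v\<in>{-1..1}. F_gcrn l v = 0} = {1}"
      using pos by (auto simp: F_gcrn_eq[OF l])
    have "F_gcrn l = (\<lambda>v. (1 - v) * skew_acc l 0)"
      using F_gcrn_eq[OF l] by blast
    moreover have "((\<lambda>v. (1 - v) * skew_acc l 0) has_real_derivative - skew_acc l 0) (at 1)"
      by (auto intro!: derivative_eq_intros)
    ultimately show "\<exists>D. (F_gcrn l has_real_derivative D) (at 1) \<and> D < 0"
      using pos by auto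
  qed
  show "\<exists>vcrn :: real \<Rightarrow> real. \<exists>vrefl :: real \<Rightarrow> real \<Rightarrow> real.
      (\<forall>l1>0.
          vcrn l1 \<in> {0<..<1}
        \<and> {v\<in>{-1..1}. F_crn l1 v = 0} = {vcrn l1, 1}
        \<and> (\<exists>D. (F_crn l1 has_real_derivative D) (at (vcrn l1)) \<and> D < 0)
        \<and> (\<forall>\<^sub>F v in at_left 1. F_crn l1 differentiable (at v))
        \<and> filterlim (deriv (F_crn l1)) at_top (at_left 1))
    \<and> (\<forall>l1>0. \<forall>\<epsilon>>1.
          vrefl l1 \<epsilon> \<in> {vcrn l1<..<1}
        \<and> {v\<in>{-1..1}. F_refl l1 \<epsilon> v = 0} = {vrefl l1 \<epsilon>, 1}
        \<and> (\<exists>D. (F_refl l1 \<epsilon> has_real_derivative D) (at (vrefl l1 \<epsilon>)) \<and> D < 0)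
        \<and> (\<forall>\<^sub>F v in at_left 1. F_refl l1 \<epsilon> differentiable (at v))
        \<and> filterlim (deriv (F_refl l1 \<epsilon>)) at_top (at_left 1))
    \<and> (\<forall>l1>0. (\<forall>\<epsilon>1 \<epsilon>2. 1 < \<epsilon>1 \<longrightarrow> \<epsilon>1 < \<epsilon>2 \<longrightarrow> vrefl l1 \<epsilon>2 < vrefl l1 \<epsilon>1)
        \<and> (vrefl l1 \<longlongrightarrow> 1) (at_right 1)
        \<and> (vrefl l1 \<longlongrightarrow> vcrn l1) at_top)
    \<and> (\<forall>l1 l2. 0 < l1 \<longrightarrow> l1 < l2 \<longrightarrow> vcrn l2 < vcrn l1)
    \<and> (\<forall>\<epsilon>>1. \<forall>l1 l2. 0 < l1 \<longrightarrow> l1 < l2 \<longrightarrow> vrefl l2 \<epsilon> < vrefl l1 \<epsilon>)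
    \<and> (vcrn \<longlongrightarrow> 1) (at_right 0) \<and> (vcrn \<longlongrightarrow> 0) at_top
    \<and> (\<forall>\<epsilon>>1. ((\<lambda>l1. vrefl l1 \<epsilon>) \<longlongrightarrow> 1) (at_right 0)
              \<and> ((\<lambda>l1. vrefl l1 \<epsilon>) \<longlongrightarrow> 0) at_top)"
  \<comment> \<open>Both solution curves come from one family: a = 0 for CRN and
    \<open>a = 1 / \<epsilon>\<close> for reflection, so monotonicity in a turns into the reverse
    monotonicity in \<epsilon>.\<close>
  proof (rule exI[of _ "\<lambda>l. crossing l 0"], rule exI[of _ "\<lambda>l \<epsilon>. crossing l (1 / \<epsilon>)"],
      intro conjI allI impI)
    fix l :: real assume l: "0 < l"
    have a: "0 \<le> (0::real)" "0 < (1::real)" by simp_all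
    show "crossing l 0 \<in> {0<..<1}" using crossing(1,2)[OF l a] by simp
    show "{v \<in> {-1..1}. F_crn l v = 0} = {crossing l 0, 1}"
      unfolding F_crn_eq_drift by (rule drift_zeros[OF l a])
    show "\<exists>D. (F_crn l has_real_derivative D) (at (crossing l 0)) \<and> D < 0"
      unfolding F_crn_eq_drift by (rule crossing(4)[OF l a])
    show "\<forall>\<^sub>F v in at_left 1. F_crn l differentiable (at v)"
      unfolding F_crn_eq_drift by (rule eventually_drift_differentiable[OF l a])
    show "filterlim (deriv (F_crn l)) at_top (at_left 1)"
      unfolding F_crn_eq_drift by (rule filterlim_deriv_drift[OF l a])
    show "((\<lambda>\<epsilon>. crossing l (1 / \<epsilon>)) \<longlongrightarrow> 1) (at_right 1)"
      by (rule filterlim_compose[OF crossing_tendsto_left[OF l] filterlim_inverse_at_right_1])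
    show "((\<lambda>\<epsilon>. crossing l (1 / \<epsilon>)) \<longlongrightarrow> crossing l 0) at_top"
      by (rule filterlim_compose[OF crossing_tendsto_right[OF l] filterlim_inverse_at_top_0])
    show "crossing l (1 / \<epsilon>2) < crossing l (1 / \<epsilon>1)" if "1 < \<epsilon>1" "\<epsilon>1 < \<epsilon>2" for \<epsilon>1 \<epsilon>2 :: real
      using that by (intro crossing_strict_mono[OF l] divide_strict_left_mono) auto
    show "crossing l2 0 < crossing l 0" if "l < l2" for l2
      using crossing_antimono_step[OF l that a] .
    fix \<epsilon> :: real assume \<epsilon>: "1 < \<epsilon>"
    note a = inverse_of_greater_1(1,3)[OF \<epsilon>]
    show "crossing l (1 / \<epsilon>) \<in> {crossing l 0<..<1}"
      using crossing(2)[OF l a] crossing_strict_mono[OF l order_refl inverse_of_greater_1(2,3)[OF \<epsilon>]] by simp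
    show "{v \<in> {-1..1}. F_refl l \<epsilon> v = 0} = {crossing l (1 / \<epsilon>), 1}"
      unfolding F_refl_eq_drift by (rule drift_zeros[OF l a])
    show "\<exists>D. (F_refl l \<epsilon> has_real_derivative D) (at (crossing l (1 / \<epsilon>))) \<and> D < 0"
      unfolding F_refl_eq_drift by (rule crossing(4)[OF l a])
    show "\<forall>\<^sub>F v in at_left 1. F_refl l \<epsilon> differentiable (at v)"
      unfolding F_refl_eq_drift by (rule eventually_drift_differentiable[OF l a])
    show "filterlim (deriv (F_refl l \<epsilon>)) at_top (at_left 1)"
      unfolding F_refl_eq_drift by (rule filterlim_deriv_drift[OF l a])
  next
    fix \<epsilon> l1 l2 :: real assume "1 < \<epsilon>" "0 < l1" "l1 < l2"
    then show "crossing l2 (1 / \<epsilon>) < crossing l1 (1 / \<epsilon>)"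
      using crossing_antimono_step inverse_of_greater_1(1,3) by blast
  next
    fix \<epsilon> :: real assume \<epsilon>: "1 < \<epsilon>"
    show "((\<lambda>l. crossing l (1 / \<epsilon>)) \<longlongrightarrow> 1) (at_right 0)"
      by (rule crossing_tendsto_1[OF inverse_of_greater_1(1,3)[OF \<epsilon>]])
    show "((\<lambda>l. crossing l (1 / \<epsilon>)) \<longlongrightarrow> 0) at_top"
      by (rule crossing_tendsto_0[OF inverse_of_greater_1(1,3)[OF \<epsilon>]])
  next
    show "((\<lambda>l. crossing l 0) \<longlongrightarrow> 1) (at_right 0)"
      by (rule crossing_tendsto_1) simp_all
    show "((\<lambda>l. crossing l 0) \<longlongrightarrow> 0) at_top"
      by (rule crossing_tendsto_0) simp_all
  qed
qed

end
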